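(* Let $\mathbf{p}(t)$ be a non-degenerate planar rational cubic Bézier curve with control points $\mathbf{c}_0,\dots,\mathbf{c}_3\in\mathbb{R}^2$, no three of which are collinear, and real weights $w_0,\dots,w_3$. Suppose that the double point $\mathbf{s}$ of the curve is not at infinity. Then its location is given by the barycentric combination $$\mathbf{s}=\frac{\mathbf{c}_0\lambda_1\phi_1\phi_3u_2^2+\frac12(\mathbf{c}_0\lambda_0-\mathbf{c}_1\lambda_1+\mathbf{c}_2\lambda_2-\mathbf{c}_3\lambda_3)\phi_1\phi_2u_1u_2-\mathbf{c}_3\lambda_2\phi_2\phi_3u_1^2}{\lambda_1\phi_1\phi_3u_2^2+\frac12(\lambda_0-\lambda_1+\lambda_2-\lambda_3)\phi_1\phi_2u_1u_2-\lambda_2\phi_2\phi_3u_1^2}.$$ Moreover, in the barycentric coordinate system defined by $\mathbf{c}_0,\mathbf{c}_2,\mathbf{c}_3$, $$\mathbf{s}=\frac{\mathbf{c}_0\phi_1^2u_2u_3-\mathbf{c}_2\phi_1\phi_2u_1u_2+\mathbf{c}_3\phi_2\phi_3u_1^2}{\phi_1^2u_2u_3-\phi_1\phi_2u_1u_2+\phi_2\phi_3u_1^2},$$ and in the barycentric coordinate system defined by $\mathbf{c}_0,\mathbf{c}_1,\mathbf{c}_3$, $$\mathbf{s}=\frac{\mathbf{c}_0\phi_1\phi_3u_2^2-\mathbf{c}_1\phi_1\phi_2u_1u_2+\mathbf{c}_3\phi_2^2u_1u_0}{\phi_1\phi_3u_2^2-\phi_1\phi_2u_1u_2+\phi_2^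2u_1u_0}.$$
   Context: For $\mathbf{c}_i=(c_{i,0},c_{i,1})\in\mathbb{R}^2$ and real weights $w_i$ ($i=0,1,2,3$), the rational cubic Bézier curve is $$\mathbf{p}(t)=\frac{\mathbf{c}_0w_0(1-t)^3+3\mathbf{c}_1w_1(1-t)^2t+3\mathbf{c}_2w_2(1-t)t^2+\mathbf{c}_3w_3t^3}{w_0(1-t)^3+3w_1(1-t)^2t+3w_2(1-t)t^2+w_3t^3},$$ and $u_i=\binom{3}{i}w_i$. $\lambda_{ijk}=\begin{vmatrix}c_{i,0}&c_{i,1}&1\\c_{j,0}&c_{j,1}&1\\c_{k,0}&c_{k,1}&1\end{vmatrix}$, and $\lambda_0=\lambda_{321}$, $\lambda_1=\lambda_{230}$, $\lambda_2=\lambda_{103}$, $\lambda_3=\lambda_{012}$. Further $$\phi_1=u_0u_2\lambda_1^2-u_1^2\lambda_0\lambda_2,\quad\phi_2=u_1u_3\lambda_2^2-u_2^2\lambda_1\lambda_3,\quad\phi_3=u_1u_2\lambda_0\lambda_3-u_0u_3\lambda_1\lambda_2.$$ The curve is non-degenerate if it does not degenerate to a conic section or a line, i.e. no nonzero polynomial in $x,y$ of total degree at most $2$ vanishes identically on $\mathbf{p}(t)$. A non-degenerate curve has an implicit equation $q(x,y)=0$ with $q$ a cubic polynomial, unique up to a nonzero constant, and the projective cubic curve so defined has exactly one singular point, its double point (a crunode, acnode or cusp). When it is not at infinity it is the point where $q$ and $\nabla q$ both vanish. *)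

theory Defs
  imports "HOL-Analysis.Analysis" "HOL-Computational_Algebra.Polynomial"
begin

text \<open>Points of the plane are pairs of reals. Control points \<open>c\<close> and weights \<open>w\<close> are
  indexed by \<open>nat\<close>; only the indices 0, 1, 2, 3 are ever used.\<close>

definition bez_u :: "(nat \<Rightarrow> real) \<Rightarrow> nat \<Rightarrow> real" where
  "bez_u w i = real (3 choose i) * w i"

text \<open>\<open>Bernstein n k t\<close> is \<open>(n choose k) * t ^ k * (1 - t) ^ (n - k)\<close>. The value
  \<open>bez_point c w t\<close> is meaningful only where \<open>bez_denom w t\<close> is nonzero.\<close>

definition bez_denom :: "(nat \<Rightarrow> real) \<Rightarrow> real \<Rightarrow> real" where
  "bez_denom w t = (\<Sum>i\<le>3. w i * Bernstein 3 i t)"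

definition bez_point :: "(nat \<Rightarrow> real \<times> real) \<Rightarrow> (nat \<Rightarrow> real) \<Rightarrow> real \<Rightarrow> real \<times> real" where
  "bez_point c w t = (\<Sum>i\<le>3. (w i * Bernstein 3 i t) *\<^sub>R c i) /\<^sub>R bez_denom w t"

text \<open>Polynomials in \<open>x\<close>, \<open>y\<close> are represented as polynomials in \<open>y\<close> whose coefficients are
  polynomials in \<open>x\<close>: the coefficient of \<open>x ^ j * y ^ i\<close> in \<open>q\<close> is \<open>coeff (coeff q i) j\<close>.\<close>

definition eval_xy :: "real poly poly \<Rightarrow> real \<times> real \<Rightarrow> real" where
  "eval_xy q P = poly (poly q [:snd P:]) (fst P)"

definition pderiv_x :: "real poly poly \<Rightarrow> real poly poly" where
  "pderiv_x q = map_poly pderiv q"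

definition pderiv_y :: "real poly poly \<Rightarrow> real poly poly" where
  "pderiv_y q = pderiv q"

definition total_degree_le :: "nat \<Rightarrow> real poly poly \<Rightarrow> bool" where
  "total_degree_le d q \<longleftrightarrow> (\<forall>i j. coeff (coeff q i) j \<noteq> 0 \<longrightarrow> i + j \<le> d)"

definition vanishes_on_curve ::
    "(nat \<Rightarrow> real \<times> real) \<Rightarrow> (nat \<Rightarrow> real) \<Rightarrow> real poly poly \<Rightarrow> bool" where
  "vanishes_on_curve c w q \<longleftrightarrow> (\<forall>t. bez_denom w t \<noteq> 0 \<longrightarrow> eval_xy q (bez_point c w t) = 0)"

definition nondegenerate_curve :: "(nat \<Rightarrow> real \<times> real) \<Rightarrow> (nat \<Rightarrow> real) \<Rightarrow> bool" where
  "nondegenerate_curve c w \<longleftrightarrow>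
     (\<forall>q. q \<noteq> 0 \<longrightarrow> total_degree_le 2 q \<longrightarrow> \<not> vanishes_on_curve c w q)"

definition implicit_cubic ::
    "(nat \<Rightarrow> real \<times> real) \<Rightarrow> (nat \<Rightarrow> real) \<Rightarrow> real poly poly \<Rightarrow> bool" where
  "implicit_cubic c w q \<longleftrightarrow>
     total_degree_le 3 q \<and> \<not> total_degree_le 2 q \<and> vanishes_on_curve c w q"

text \<open>For a non-degenerate curve the implicit cubic is unique up to a nonzero constant, so the
  existential quantifier amounts to speaking of \<^emph>\<open>the\<close> implicit equation. That some \<open>s\<close> satisfies
  this predicate says that the double point of the projective closure is not at infinity: the
  double point, being the only complex singular point of a cubic with real coefficients, is real.\<close>

definition is_finite_double_point ::
    "(nat \<Rightarrow> real \<times> real) \<Rightarrow> (nat \<Rightarrow> real) \<Rightarrow> real \<times> real \<Rightarrow> bool" where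
  "is_finite_double_point c w s \<longleftrightarrow>
     (\<exists>q. implicit_cubic c w q \<and> eval_xy q s = 0 \<and>
          eval_xy (pderiv_x q) s = 0 \<and> eval_xy (pderiv_y q) s = 0)"

definition lam_det :: "(nat \<Rightarrow> real \<times> real) \<Rightarrow> nat \<Rightarrow> nat \<Rightarrow> nat \<Rightarrow> real" where
  "lam_det c i j k =
     det (vector [vector [fst (c i), snd (c i), 1],
                  vector [fst (c j), snd (c j), 1],
                  vector [fst (c k), snd (c k), 1]] :: real^3^3)"

definition lam0 :: "(nat \<Rightarrow> real \<times> real) \<Rightarrow> real" where "lam0 c = lam_det c 3 2 1"
definition lam1 :: "(nat \<Rightarrow> real \<times> real) \<Rightarrow> real" where "lam1 c = lam_det c 2 3 0"
definition lam2 :: "(nat \<Rightarrow> real \<times> real) \<Rightarrow> real" where "lam2 c = lam_det c 1 0 3"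
definition lam3 :: "(nat \<Rightarrow> real \<times> real) \<Rightarrow> real" where "lam3 c = lam_det c 0 1 2"

definition phi1 :: "(nat \<Rightarrow> real \<times> real) \<Rightarrow> (nat \<Rightarrow> real) \<Rightarrow> real" where
  "phi1 c w = bez_u w 0 * bez_u w 2 * (lam1 c)\<^sup>2 - (bez_u w 1)\<^sup>2 * lam0 c * lam2 c"

definition phi2 :: "(nat \<Rightarrow> real \<times> real) \<Rightarrow> (nat \<Rightarrow> real) \<Rightarrow> real" where
  "phi2 c w = bez_u w 1 * bez_u w 3 * (lam2 c)\<^sup>2 - (bez_u w 2)\<^sup>2 * lam1 c * lam3 c"

definition phi3 :: "(nat \<Rightarrow> real \<times> real) \<Rightarrow> (nat \<Rightarrow> real) \<Rightarrow> real" where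
  "phi3 c w = bez_u w 1 * bez_u w 2 * lam0 c * lam3 c - bez_u w 0 * bez_u w 3 * lam1 c * lam2 c"

end

theory Submission
  imports Defs
    "HOL-Computational_Algebra.Field_as_Ring" "HOL-Computational_Algebra.Polynomial_Factorial"
begin

text \<open>
  Write \<open>h\<^sub>i = (c\<^sub>i, 1)\<close> for the homogeneous control points in \<open>\<real>\<^sup>3\<close>. The curve lifts to
  \<open>P(s, t) = u\<^sub>0 s\<^sup>3 h\<^sub>0 + u\<^sub>1 s\<^sup>2 t h\<^sub>1 + u\<^sub>2 s t\<^sup>2 h\<^sub>2 + u\<^sub>3 t\<^sup>3 h\<^sub>3\<close>, and the numbers \<open>\<lambda>\<^sub>i\<close>, all nonzero,
  are the coefficients of the one linear relation \<open>\<Sum> \<lambda>\<^sub>i h\<^sub>i = 0\<close>.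

  The formulas come from the line \<open>s A + t B\<close> (with \<open>A\<close>, \<open>B\<close> covectors) that moves linearly with the
  parameter and always passes through \<open>P(s, t)\<close>. Comparing coefficients in
  \<open>(s A + t B) \<bullet> P(s, t) = 0\<close> gives \<open>A\<close> and \<open>B\<close> explicitly in terms of the \<open>\<phi>\<^sub>i\<close> (lemma
  \<open>moving_line\<close>): their values on the \<open>h\<^sub>i\<close> are \<open>(0, -u\<^sub>0\<phi>\<^sub>2, -u\<^sub>1\<phi>\<^sub>3, -u\<^sub>2\<phi>\<^sub>1)\<close> and
  \<open>(u\<^sub>1\<phi>\<^sub>2, u\<^sub>2\<phi>\<^sub>3, u\<^sub>3\<phi>\<^sub>1, 0)\<close>. All these lines pass through the vertex \<open>v = A \<times> B\<close>, and expanding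
  \<open>\<lambda>\<^sub>1 v\<close> in the basis \<open>h\<^sub>0, h\<^sub>2, h\<^sub>3\<close> yields exactly the second formula. The other two are the same
  vector up to a nonzero factor, rewritten by \<open>\<Sum> \<lambda>\<^sub>i h\<^sub>i = 0\<close> and two linear relations between the
  \<open>\<phi>\<^sub>i\<close>. The vector \<open>v\<close> is nonzero, since otherwise \<open>P\<close> would vanish at a parameter value or stay in
  a plane through the origin, and either way the curve would lie on a conic (lemma \<open>vertex_coefficients_nonzero\<close>).

  It remains to see that a singular point of the implicit cubic has to be the vertex (lemma
  \<open>singular_point_unique\<close>). The moving line gives \<open>A \<bullet> P = t g\<close> and \<open>B \<bullet> P = - s g\<close> with a
  quadratic form \<open>g\<close>, so \<open>P = m v + g (t e\<^sub>1 + s e\<^sub>2)\<close> in a basis \<open>v, e\<^sub>1, e\<^sub>2\<close>; here \<open>g\<close> and the cubic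
  form \<open>m\<close> are coprime by non-degeneracy. Let \<open>T\<close> be the symmetric trilinear form with
  \<open>T(X, X, X)\<close> the homogenised cubic, and \<open>E = t e\<^sub>1 + s e\<^sub>2\<close>. Then
  \<open>0 = T(P, P, P) = m\<^sup>3 T(v,v,v) + 3 m\<^sup>2 g T(v,v,E) + 3 m g\<^sup>2 T(v,E,E) + g\<^sup>3 T(E,E,E)\<close>, and divisibility
  by \<open>g\<close>, used three times, forces \<open>T(v,v,v) = 0\<close>, \<open>T(v,v,E) = 0\<close>, \<open>3 T(v,E,E) = r g\<close> and
  \<open>T(E,E,E) = - r m\<close> for a constant \<open>r\<close>, which is nonzero. If \<open>z v + E\<close> is singular, then
  \<open>T(v,E,E) = 0\<close> and \<open>T(E,E,E) = 0\<close>, so \<open>g\<close> and \<open>m\<close> both vanish at \<open>(s, t)\<close>; hence \<open>s = t = 0\<close> and the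
  point is \<open>z v\<close>.
\<close>

unbundle cross3_syntax

section \<open>Binary forms and a divisibility argument\<close>

text \<open>The coefficients are those of a univariate polynomial, so that setting \<open>s = 1\<close> recovers this
  polynomial, while the form remembers a degree \<open>n\<close> that may exceed the degree of the polynomial
  (that is, zeros at \<open>s = 0\<close> are not lost).\<close>

definition binary_form :: "nat \<Rightarrow> (real \<Rightarrow> real \<Rightarrow> real) \<Rightarrow> bool" where
  "binary_form n f \<longleftrightarrow>
     (\<exists>p. degree p \<le> n \<and> (\<forall>s t. f s t = (\<Sum>i\<le>n. coeff p i * s ^ (n - i) * t ^ i)))"

lemma poly_eq_sum_upto:
  fixes p :: "'a::comm_semiring_1 poly"
  assumes "degree p \<le> n"
  shows "poly p x = (\<Sum>i\<le>n. coeff p i * x ^ i)"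
  unfolding poly_altdef using assms by (intro sum.mono_neutral_left) (auto simp: coeff_eq_0)

lemma binary_formE:
  assumes "binary_form n f"
  obtains p where "degree p \<le> n" "\<And>z. f 1 z = poly p z" "f 0 1 = coeff p n"
    "\<And>s t. f s t = (\<Sum>i\<le>n. coeff p i * s ^ (n - i) * t ^ i)"
proof -
  obtain p where p: "degree p \<le> n" "\<And>s t. f s t = (\<Sum>i\<le>n. coeff p i * s ^ (n - i) * t ^ i)"
    using assms by (auto simp: binary_form_def)
  have "f 1 z = poly p z" for z
    using poly_eq_sum_upto[OF p(1)] by (simp add: p(2))
  moreover have "f 0 1 = (\<Sum>i\<le>n. if i = n then coeff p n else 0)"
    unfolding p(2) by (intro sum.cong) (auto simp: power_0_left)
  ultimately show ?thesis using that p by simp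
qed

lemma binary_form_1I: "(\<And>s t. f s t = a * s + b * t) \<Longrightarrow> binary_form 1 f"
  unfolding binary_form_def by (intro exI[of _ "[:a, b:]"]) simp

lemma binary_form_2I: "(\<And>s t. f s t = a * s\<^sup>2 + b * s * t + d * t\<^sup>2) \<Longrightarrow> binary_form 2 f"
  unfolding binary_form_def
  by (intro exI[of _ "[:a, b, d:]"]) (simp add: eval_nat_numeral)

lemma binary_form_3I:
  "(\<And>s t. f s t = a * s ^ 3 + b * s\<^sup>2 * t + d * s * t\<^sup>2 + e * t ^ 3) \<Longrightarrow> binary_form 3 f"
  unfolding binary_form_def
  by (intro exI[of _ "[:a, b, d, e:]"]) (simp add: eval_nat_numeral)

lemma binary_form_1E:
  assumes "binary_form 1 f" obtains a b where "\<And>s t. f s t = a * s + b * t"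
  using assms unfolding binary_form_def by (auto simp: eval_nat_numeral)

lemma binary_form_2E:
  assumes "binary_form 2 f" obtains a b d where "\<And>s t. f s t = a * s\<^sup>2 + b * s * t + d * t\<^sup>2"
  using assms unfolding binary_form_def by (auto simp: eval_nat_numeral)

lemma binary_form_3E:
  assumes "binary_form 3 f"
  obtains a b d e where "\<And>s t. f s t = a * s ^ 3 + b * s\<^sup>2 * t + d * s * t\<^sup>2 + e * t ^ 3"
  using assms unfolding binary_form_def by (auto simp: eval_nat_numeral)

text \<open>Shears move the zeros of a form away from \<open>s = 0\<close>; they reduce the divisibility argument to
  univariate polynomials of full degree.\<close>

lemma binary_form_shear:
  shows "binary_form 1 f \<Longrightarrow> binary_form 1 (\<lambda>s t. f (s + b * t) t)"
    and "binary_form 2 f \<Longrightarrow> binary_form 2 (\<lambda>s t. f (s + b * t) t)"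
    and "binary_form 3 f \<Longrightarrow> binary_form 3 (\<lambda>s t. f (s + b * t) t)"
proof -
  show "binary_form 1 (\<lambda>s t. f (s + b * t) t)" if f: "binary_form 1 f"
  proof -
    obtain x y where "\<And>s t. f s t = x * s + y * t" using binary_form_1E[OF f] by blast
    then show ?thesis
      by (intro binary_form_1I[of _ x "x * b + y"]) (simp add: algebra_simps)
  qed
  show "binary_form 2 (\<lambda>s t. f (s + b * t) t)" if f: "binary_form 2 f"
  proof -
    obtain x y z where "\<And>s t. f s t = x * s\<^sup>2 + y * s * t + z * t\<^sup>2"
      using binary_form_2E[OF f] by blast
    then show ?thesis
      by (intro binary_form_2I[of _ x "2 * x * b + y" "x * b\<^sup>2 + y * b + z"])
        (simp add: algebra_simps power2_eq_square power3_eq_cube)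
  qed
  show "binary_form 3 (\<lambda>s t. f (s + b * t) t)" if f: "binary_form 3 f"
  proof -
    obtain x y z v where "\<And>s t. f s t = x * s ^ 3 + y * s\<^sup>2 * t + z * s * t\<^sup>2 + v * t ^ 3"
      using binary_form_3E[OF f] by blast
    then show ?thesis
      by (intro binary_form_3I[of _ x "3 * x * b + y" "3 * x * b\<^sup>2 + 2 * y * b + z"
            "x * b ^ 3 + y * b\<^sup>2 + z * b + v"]) (simp add: algebra_simps power2_eq_square power3_eq_cube)
  qed
qed

lemma binary_form_eq_scaled:
  assumes "binary_form n f" "binary_form n h" "\<And>z. f 1 z = r * h 1 z"
  shows "f s t = r * h s t"
proof -
  obtain p where p: "\<And>z. f 1 z = poly p z"
    "\<And>s t. f s t = (\<Sum>i\<le>n. coeff p i * s ^ (n - i) * t ^ i)"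
    using binary_formE[OF assms(1)] by metis
  obtain q where q: "\<And>z. h 1 z = poly q z"
    "\<And>s t. h s t = (\<Sum>i\<le>n. coeff q i * s ^ (n - i) * t ^ i)"
    using binary_formE[OF assms(2)] by metis
  have "p = smult r q"
    using assms(3) by (auto simp: p(1) q(1) simp flip: poly_eq_poly_eq_iff)
  then show ?thesis by (simp add: p(2) q(2) sum_distrib_left mult_ac)
qed

text \<open>A proper non-constant factor of a quadratic is linear and so has a real root. Hence complex roots
  need not be considered: a pair of conjugate common roots would make \<open>G\<close> divide \<open>M\<close>.\<close>

lemma coprime_quadratic_polyI:
  fixes G M :: "real poly"
  assumes G: "degree G = 2" and root: "\<And>z. poly G z = 0 \<Longrightarrow> poly M z \<noteq> 0" and ndvd: "\<not> G dvd M"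
  shows "coprime G M"
proof (rule coprimeI)
  fix d assume d: "d dvd G" "d dvd M"
  have G0: "G \<noteq> 0" using G by auto
  then have d0: "d \<noteq> 0" using d(1) by auto
  have "degree d \<le> 2" using dvd_imp_degree_le[OF d(1) G0] G by simp
  moreover have "degree d \<noteq> 1"
  proof
    assume d1: "degree d = 1"
    then obtain a b where ab: "d = [:a, b:]" "b \<noteq> 0" by (rule degree1_coeffs)
    then have "poly d (- a / b) = 0" by simp
    with d have "poly G (- a / b) = 0" "poly M (- a / b) = 0" by auto
    with root show False by blast
  qed
  moreover have "degree d \<noteq> 2"
  proof
    assume d2: "degree d = 2"
    obtain e where e: "G = d * e" using d(1) by auto
    then have "degree e = 0" using G G0 d2 degree_mult_eq[of d e] by auto
    then obtain r where "e = [:r:]" by (auto elim: degree_eq_zeroE)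
    with e G0 have "G dvd d" by (simp add: mult.commute smult_dvd)
    with d(2) ndvd show False using dvd_trans by blast
  qed
  ultimately have "degree d = 0" by linarith
  then show "is_unit d" using d0 by (simp add: is_unit_iff_degree)
qed

text \<open>After setting \<open>s = 1\<close>, the form \<open>g\<close> becomes a polynomial \<open>G\<close> of degree exactly 2 that is coprime to
  the polynomial \<open>M\<close> of \<open>m\<close>. The identity shows in turn that \<open>G\<close> divides the constant \<open>k\<close>, then (after
  cancelling \<open>G\<close>) the polynomial of \<open>l\<close> of degree at most 1, then that of \<open>q\<close> of degree at most 2.\<close>

lemma form_identity_top:
  assumes m: "binary_form 3 m" and g: "binary_form 2 g" and l: "binary_form 1 l"
    and q: "binary_form 2 q" and h: "binary_form 3 h"
    and identity: "\<And>s t. k * m s t ^ 3 + (m s t)\<^sup>2 * g s t * l s t + m s t * (g s t)\<^sup>2 * q s t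
                       + g s t ^ 3 * h s t = 0"
    and no_zero: "\<And>s t. g s t = 0 \<Longrightarrow> m s t = 0 \<Longrightarrow> s = 0 \<and> t = 0"
    and no_factor: "\<And>f. binary_form 1 f \<Longrightarrow> \<exists>s t. m s t \<noteq> g s t * f s t"
    and top: "g 0 1 \<noteq> 0"
  shows "k = 0 \<and> (\<forall>s t. l s t = 0) \<and> (\<exists>r. \<forall>s t. q s t = r * g s t \<and> h s t = - r * m s t)"
proof -
  obtain M where M: "degree M \<le> 3" "\<And>z. m 1 z = poly M z" using binary_formE[OF m] by metis
  obtain G where G: "degree G \<le> 2" "\<And>z. g 1 z = poly G z" "g 0 1 = coeff G 2"
    using binary_formE[OF g] by metis
  obtain L where L: "degree L \<le> 1" "\<And>z. l 1 z = poly L z" using binary_formE[OF l] by metis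
  obtain Q where Q: "degree Q \<le> 2" "\<And>z. q 1 z = poly Q z" using binary_formE[OF q] by metis
  obtain H where H: "degree H \<le> 3" "\<And>z. h 1 z = poly H z" using binary_formE[OF h] by metis
  have degG: "degree G = 2" using G top by (metis le_antisym le_degree)
  then have G0: "G \<noteq> 0" by auto
  have "\<not> G dvd M"
  proof
    assume "G dvd M"
    then obtain F where F: "M = G * F" by auto
    have "degree F \<le> 1"
    proof (cases "F = 0")
      case False
      then show ?thesis using F M(1) degG G0 by (simp add: degree_mult_eq)
    qed simp
    then have "F = [:coeff F 0, coeff F 1:]"
      by (intro poly_eqI) (auto simp: coeff_pCons coeff_eq_0 split: nat.split)
    then obtain a b where ab: "F = [:a, b:]" by blast
    have f: "binary_form 1 (\<lambda>s t. a * s + b * t)" by (rule binary_form_1I) simp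
    obtain x y z where gc: "\<And>s t. g s t = x * s\<^sup>2 + y * s * t + z * t\<^sup>2"
      using binary_form_2E[OF g] by blast
    have gf: "binary_form 3 (\<lambda>s t. g s t * (a * s + b * t))"
      by (rule binary_form_3I[of _ "x * a" "x * b + y * a" "y * b + z * a" "z * b"])
        (simp add: gc algebra_simps power2_eq_square power3_eq_cube)
    have "m s t = 1 * (g s t * (a * s + b * t))" for s t
      by (rule binary_form_eq_scaled[OF m gf]) (simp add: M G F ab algebra_simps)
    with no_factor[OF f] show False by auto
  qed
  moreover have "poly M z \<noteq> 0" if "poly G z = 0" for z
    using no_zero[of 1 z] that by (auto simp: M G)
  ultimately have cop: "coprime G M" using coprime_quadratic_polyI degG by blast
  have pid: "smult k (M ^ 3) + M\<^sup>2 * G * L + M * G\<^sup>2 * Q + G ^ 3 * H = 0"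
    using identity[of 1] by (simp add: M G L Q H flip: poly_eq_poly_eq_iff) auto
  have "smult k (M ^ 3) = G * (- (M\<^sup>2 * L + M * G * Q + G\<^sup>2 * H))"
    using pid by (simp add: algebra_simps eval_nat_numeral add_eq_0_iff2)
  then have "G dvd [:k:] * M ^ 3" by (simp add: dvdI)
  moreover have "coprime G (M ^ 3)" using cop by simp
  ultimately have "G dvd [:k:]" using coprime_dvd_mult_left_iff by blast
  then have k: "k = 0"
    using degG dvd_imp_degree_le[of G "[:k:]"] by (cases "k = 0") auto
  then have "G * (M\<^sup>2 * L + M * G * Q + G\<^sup>2 * H) = 0"
    using pid by (simp add: algebra_simps eval_nat_numeral)
  then have pid2: "M\<^sup>2 * L + M * G * Q + G\<^sup>2 * H = 0" using G0 by simp
  then have "L * M\<^sup>2 = G * (- (M * Q + G * H))"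
    by (simp add: algebra_simps eval_nat_numeral add_eq_0_iff2)
  then have "G dvd L * M\<^sup>2" by (simp add: dvdI)
  then have "G dvd L" using cop by (simp add: coprime_dvd_mult_left_iff)
  then have L0: "L = 0" using degG L(1) dvd_imp_degree_le[of G L] by (cases "L = 0") auto
  then have "G * (M * Q + G * H) = 0" using pid2 by (simp add: algebra_simps eval_nat_numeral)
  then have pid3: "M * Q + G * H = 0" using G0 by simp
  then have "Q * M = G * (- H)" by (simp add: algebra_simps add_eq_0_iff2)
  then have "G dvd Q * M" by (simp add: dvdI)
  then have "G dvd Q" using cop by (simp add: coprime_dvd_mult_left_iff)
  then obtain R where R: "Q = G * R" by auto
  have "degree R = 0"
  proof (cases "R = 0")
    case False
    then show ?thesis using R Q(1) degG G0 by (simp add: degree_mult_eq)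
  qed simp
  then obtain r where r: "R = [:r:]" by (auto elim: degree_eq_zeroE)
  have "G * (smult r M + H) = 0" using pid3 R r by (simp add: algebra_simps)
  then have "smult r M + H = 0" using G0 by simp
  then have Hr: "H = smult (- r) M" by (simp add: add_eq_0_iff2)
  have "l s t = 0 * l s t" for s t
    by (rule binary_form_eq_scaled[OF l l]) (simp add: L L0)
  moreover have "q s t = r * g s t" for s t
    by (rule binary_form_eq_scaled[OF q g]) (simp add: Q G R r)
  moreover have "h s t = - r * m s t" for s t
    by (rule binary_form_eq_scaled[OF h m]) (simp add: H M Hr)
  ultimately show ?thesis using k by auto
qed

text \<open>The condition \<open>g 0 1 \<noteq> 0\<close> holds after a suitable shear as soon as \<open>g\<close> is not the zero form.\<close>

lemma form_identity:
  assumes m: "binary_form 3 m" and g: "binary_form 2 g" and l: "binary_form 1 l"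
    and q: "binary_form 2 q" and h: "binary_form 3 h"
    and identity: "\<And>s t. k * m s t ^ 3 + (m s t)\<^sup>2 * g s t * l s t + m s t * (g s t)\<^sup>2 * q s t
                       + g s t ^ 3 * h s t = 0"
    and no_zero: "\<And>s t. g s t = 0 \<Longrightarrow> m s t = 0 \<Longrightarrow> s = 0 \<and> t = 0"
    and no_factor: "\<And>f. binary_form 1 f \<Longrightarrow> \<exists>s t. m s t \<noteq> g s t * f s t"
    and nonzero: "g s0 t0 \<noteq> 0"
  shows "k = 0 \<and> (\<forall>s t. l s t = 0) \<and> (\<exists>r. \<forall>s t. q s t = r * g s t \<and> h s t = - r * m s t)"
proof -
  obtain x y z where gc: "\<And>s t. g s t = x * s\<^sup>2 + y * s * t + z * t\<^sup>2"
    using binary_form_2E[OF g] by blast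
  \<comment> \<open>A quadratic form that vanishes at three pairwise independent points is zero.\<close>
  have "\<exists>b. g b 1 \<noteq> 0"
  proof (rule ccontr)
    assume "\<not> ?thesis"
    then have "g 0 1 = 0" "g 1 1 = 0" "g (-1) 1 = 0" by auto
    then have "x = 0" "y = 0" "z = 0" by (auto simp: gc)
    with nonzero show False by (simp add: gc)
  qed
  then obtain b where b: "g b 1 \<noteq> 0" by blast
  define sh where "sh f s t = f (s + b * t) t" for f :: "real \<Rightarrow> real \<Rightarrow> real" and s t
  have unsh: "f s t = sh f (s - b * t) t" for f s t by (simp add: sh_def)
  have "k = 0 \<and> (\<forall>s t. sh l s t = 0)
      \<and> (\<exists>r. \<forall>s t. sh q s t = r * sh g s t \<and> sh h s t = - r * sh m s t)"
  proof (rule form_identity_top)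
    show "binary_form 3 (sh m)" "binary_form 2 (sh g)" "binary_form 1 (sh l)"
      "binary_form 2 (sh q)" "binary_form 3 (sh h)"
      using binary_form_shear m g l q h by (auto simp: sh_def[abs_def])
    show "k * sh m s t ^ 3 + (sh m s t)\<^sup>2 * sh g s t * sh l s t
        + sh m s t * (sh g s t)\<^sup>2 * sh q s t + sh g s t ^ 3 * sh h s t = 0" for s t
      using identity by (simp add: sh_def)
    show "s = 0 \<and> t = 0" if "sh g s t = 0" "sh m s t = 0" for s t
      using no_zero[of "s + b * t" t] that by (auto simp: sh_def)
    show "\<exists>s t. sh m s t \<noteq> sh g s t * f s t" if f: "binary_form 1 f" for f
    proof -
      have "binary_form 1 (\<lambda>s t. f (s + (- b) * t) t)" using binary_form_shear(1)[OF f] .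
      from no_factor[OF this] obtain s t where "m s t \<noteq> g s t * f (s - b * t) t" by auto
      then have "sh m (s - b * t) t \<noteq> sh g (s - b * t) t * f (s - b * t) t" by (simp add: sh_def)
      then show ?thesis by blast
    qed
    show "sh g 0 1 \<noteq> 0" using b by (simp add: sh_def)
  qed
  then show ?thesis using unsh by metis
qed

section \<open>Cubic forms as symmetric trilinear forms\<close>

locale symmetric_trilinear =
  fixes T :: "'a::real_vector \<Rightarrow> 'a \<Rightarrow> 'a \<Rightarrow> real"
  assumes linear_right: "linear (T x y)"
    and swap_left: "T x y z = T y x z"
    and swap_right: "T x y z = T x z y"
begin

lemma add_right: "T x y (z + z') = T x y z + T x y z'"
  using linear_add[OF linear_right] .

lemma scale_right: "T x y (r *\<^sub>R z) = r * T x y z"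
  using linear_scale[OF linear_right] by simp

lemma add_mid: "T x (y + y') z = T x y z + T x y' z"
  using add_right swap_right by metis

lemma scale_mid: "T x (r *\<^sub>R y) z = r * T x y z"
  using scale_right swap_right by metis

lemma add_left: "T (x + x') y z = T x y z + T x' y z"
  using add_mid swap_left by metis

lemma scale_left: "T (r *\<^sub>R x) y z = r * T x y z"
  using scale_mid swap_left by metis

lemmas expand = add_left add_mid add_right scale_left scale_mid scale_right

lemma binomial2: "T (r *\<^sub>R x + y) (r *\<^sub>R x + y) z = r\<^sup>2 * T x x z + 2 * r * T x y z + T y y z"
  using swap_left[of y x z] by (simp add: expand power2_eq_square algebra_simps)

lemma binomial3:
  "T (r *\<^sub>R x + q *\<^sub>R y) (r *\<^sub>R x + q *\<^sub>R y) (r *\<^sub>R x + q *\<^sub>R y)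
     = r ^ 3 * T x x x + 3 * r\<^sup>2 * q * T x x y + 3 * r * q\<^sup>2 * T x y y + q ^ 3 * T y y y"
proof -
  have "T y x x = T x x y" "T x y x = T x x y" "T y y x = T x y y" "T y x y = T x y y"
    using swap_left swap_right by metis+
  then show ?thesis
    by (simp add: expand power2_eq_square power3_eq_cube algebra_simps)
qed

text \<open>Restricting some arguments to the span of two vectors gives binary forms in the coordinates.\<close>

lemma pencil_forms:
  shows "binary_form 1 (\<lambda>s t. T x y (t *\<^sub>R e1 + s *\<^sub>R e2))"
    and "binary_form 2 (\<lambda>s t. T x (t *\<^sub>R e1 + s *\<^sub>R e2) (t *\<^sub>R e1 + s *\<^sub>R e2))"
    and "binary_form 3 (\<lambda>s t. T (t *\<^sub>R e1 + s *\<^sub>R e2) (t *\<^sub>R e1 + s *\<^sub>R e2) (t *\<^sub>R e1 + s *\<^sub>R e2))"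
proof -
  show "binary_form 1 (\<lambda>s t. T x y (t *\<^sub>R e1 + s *\<^sub>R e2))"
    by (rule binary_form_1I[of _ "T x y e2" "T x y e1"]) (simp add: expand)
  show "binary_form 2 (\<lambda>s t. T x (t *\<^sub>R e1 + s *\<^sub>R e2) (t *\<^sub>R e1 + s *\<^sub>R e2))"
    using swap_right[of x e2 e1]
    by (intro binary_form_2I[of _ "T x e2 e2" "2 * T x e1 e2" "T x e1 e1"])
      (simp add: expand power2_eq_square algebra_simps)
  show "binary_form 3 (\<lambda>s t. T (t *\<^sub>R e1 + s *\<^sub>R e2) (t *\<^sub>R e1 + s *\<^sub>R e2) (t *\<^sub>R e1 + s *\<^sub>R e2))"
    by (rule binary_form_3I[of _ "T e2 e2 e2" "3 * T e1 e2 e2" "3 * T e1 e1 e2" "T e1 e1 e1"])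
      (simp add: binomial3)
qed

text \<open>Here \<open>v\<close> is the common point of the moving lines. The expansion of \<open>T P P P\<close> in powers of \<open>m\<close> and
  \<open>g\<close> determines the cubic up to the factor \<open>r\<close>: it is \<open>z r g - r m\<close> at the point \<open>z v + E\<close>. A singular
  point off \<open>v\<close> would therefore be a common zero of \<open>g\<close> and \<open>m\<close>.\<close>

lemma singular_point_unique:
  assumes m: "binary_form 3 m" and g: "binary_form 2 g"
    and on_cubic: "\<And>s t. let P = m s t *\<^sub>R v + g s t *\<^sub>R (t *\<^sub>R e1 + s *\<^sub>R e2) in T P P P = 0"
    and no_zero: "\<And>s t. g s t = 0 \<Longrightarrow> m s t = 0 \<Longrightarrow> s = 0 \<and> t = 0"
    and no_factor: "\<And>f. binary_form 1 f \<Longrightarrow> \<exists>s t. m s t \<noteq> g s t * f s t"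
    and nonzero: "g s0 t0 \<noteq> 0"
    and spanning: "\<And>x. \<exists>z a b. x = z *\<^sub>R v + (a *\<^sub>R e1 + b *\<^sub>R e2)"
    and nontrivial: "T x0 x0 x0 \<noteq> 0"
    and singular: "\<And>x. T p p x = 0"
  shows "\<exists>z. p = z *\<^sub>R v"
proof -
  define E where "E s t = t *\<^sub>R e1 + s *\<^sub>R e2" for s t
  have forms: "binary_form 1 (\<lambda>s t. 3 * T v v (E s t))" "binary_form 2 (\<lambda>s t. 3 * T v (E s t) (E s t))"
    "binary_form 3 (\<lambda>s t. T (E s t) (E s t) (E s t))"
  proof -
    interpret T3: symmetric_trilinear "\<lambda>x y z. 3 * T x y z"
      using swap_left swap_right by unfold_locales (auto intro!: linearI simp: expand)
    show "binary_form 1 (\<lambda>s t. 3 * T v v (E s t))" "binary_form 2 (\<lambda>s t. 3 * T v (E s t) (E s t))"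
      "binary_form 3 (\<lambda>s t. T (E s t) (E s t) (E s t))"
      unfolding E_def by (rule T3.pencil_forms pencil_forms)+
  qed
  have identity: "T v v v * m s t ^ 3 + (m s t)\<^sup>2 * g s t * (3 * T v v (E s t))
      + m s t * (g s t)\<^sup>2 * (3 * T v (E s t) (E s t)) + g s t ^ 3 * T (E s t) (E s t) (E s t) = 0" for s t
    using on_cubic[of s t] by (simp add: Let_def E_def[symmetric] binomial3 mult_ac)
  have "T v v v = 0 \<and> (\<forall>s t. 3 * T v v (E s t) = 0)
      \<and> (\<exists>r. \<forall>s t. 3 * T v (E s t) (E s t) = r * g s t
                \<and> T (E s t) (E s t) (E s t) = - r * m s t)"
    by (rule form_identity[OF m g forms identity _ no_factor nonzero]) (use no_zero in blast)
  then obtain r where kvv: "T v v v = 0" and lv: "\<forall>s t. 3 * T v v (E s t) = 0"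
    and r: "\<forall>s t. 3 * T v (E s t) (E s t) = r * g s t
                \<and> T (E s t) (E s t) (E s t) = - r * m s t" by blast
  have lv: "T v v (E s t) = 0" for s t using lv by simp
  have r: "3 * T v (E s t) (E s t) = r * g s t" "T (E s t) (E s t) (E s t) = - r * m s t" for s t
    using r by blast+
  have coords: "\<exists>z s t. x = z *\<^sub>R v + E s t" for x
    using spanning unfolding E_def by blast
  have diag: "T (z *\<^sub>R v + E s t) (z *\<^sub>R v + E s t) (z *\<^sub>R v + E s t)
      = z * r * g s t - r * m s t" for z s t
    using binomial3[of z v 1 "E s t"] kvv lv[of s t] r[of s t] by (simp add: mult_ac)
  have "r \<noteq> 0" using nontrivial coords[of x0] diag by auto
  obtain z s t where p: "p = z *\<^sub>R v + E s t" using coords by blast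
  have "T p p v = T v (E s t) (E s t)"
    using kvv lv[of s t] swap_right[of v "E s t" v] swap_right[of "E s t" "E s t" v]
      swap_left[of "E s t" v "E s t"]
    by (simp add: p binomial2)
  with singular r(1)[of s t] \<open>r \<noteq> 0\<close> have g0: "g s t = 0" by simp
  have "T p p p = - r * m s t" using diag g0 by (simp add: p)
  with singular \<open>r \<noteq> 0\<close> have m0: "m s t = 0" by simp
  have "s = 0" "t = 0" using no_zero[OF g0 m0] by simp_all
  then have "p = z *\<^sub>R v" by (simp add: p E_def)
  then show ?thesis by (rule exI)
qed

end

section \<open>Plane cubics and their polar forms\<close>

text \<open>The symmetrisation of the monomial \<open>X\<^sub>i X\<^sub>j X\<^sub>k\<close> over the six orderings of the three arguments.\<close>

definition monomial_polar :: "3 \<Rightarrow> 3 \<Rightarrow> 3 \<Rightarrow> real^3 \<Rightarrow> real^3 \<Rightarrow> real^3 \<Rightarrow> real" where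
  "monomial_polar i j k x y z =
     (x$i * y$j * z$k + x$i * y$k * z$j + x$j * y$i * z$k + x$j * y$k * z$i
      + x$k * y$i * z$j + x$k * y$j * z$i) / 6"

text \<open>The polar form of the cubic form that homogenises \<open>q\<close>; the coordinates 1, 2, 3 stand for \<open>x\<close>, \<open>y\<close> and
  the homogenising variable.\<close>

definition cubic_polar :: "real poly poly \<Rightarrow> real^3 \<Rightarrow> real^3 \<Rightarrow> real^3 \<Rightarrow> real" where
  "cubic_polar q x y z = (let k = (\<lambda>i j. coeff (coeff q i) j) in
     k 0 0 * monomial_polar 3 3 3 x y z + k 0 1 * monomial_polar 1 3 3 x y z
     + k 0 2 * monomial_polar 1 1 3 x y z + k 0 3 * monomial_polar 1 1 1 x y z
     + k 1 0 * monomial_polar 2 3 3 x y z + k 1 1 * monomial_polar 1 2 3 x y z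
     + k 1 2 * monomial_polar 1 1 2 x y z + k 2 0 * monomial_polar 2 2 3 x y z
     + k 2 1 * monomial_polar 1 2 2 x y z + k 3 0 * monomial_polar 2 2 2 x y z)"

definition homogeneous_point :: "real \<times> real \<Rightarrow> real^3" where
  "homogeneous_point p = vector [fst p, snd p, 1]"

lemma homogeneous_point_nth [simp]:
  "homogeneous_point p $ 1 = fst p" "homogeneous_point p $ 2 = snd p" "homogeneous_point p $ 3 = 1"
  by (simp_all add: homogeneous_point_def)

lemma symmetric_trilinear_cubic_polar: "symmetric_trilinear (cubic_polar q)"
proof (rule symmetric_trilinear.intro)
  show "linear (cubic_polar q x y)" for x y
    by (rule linearI) (simp_all add: cubic_polar_def monomial_polar_def Let_def algebra_simps add_divide_distrib)
  show "cubic_polar q x y z = cubic_polar q y x z" for x y z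
    by (simp add: cubic_polar_def monomial_polar_def Let_def algebra_simps)
  show "cubic_polar q x y z = cubic_polar q x z y" for x y z
    by (simp add: cubic_polar_def monomial_polar_def Let_def algebra_simps)
qed

lemma total_degree_leD:
  assumes "total_degree_le d q"
  shows "degree q \<le> d" "degree (coeff q i) \<le> d" "d < i + j \<Longrightarrow> coeff (coeff q i) j = 0"
proof -
  show 1: "d < i + j \<Longrightarrow> coeff (coeff q i) j = 0" for i j
    using assms unfolding total_degree_le_def by (metis not_less)
  show "degree q \<le> d" by (intro degree_le) (auto intro!: poly_eqI simp: 1)
  show "degree (coeff q i) \<le> d" by (intro degree_le) (auto simp: 1)
qed

lemma eval_xy_sum:
  assumes "total_degree_le d q"
  shows "eval_xy q (x, y) = (\<Sum>i\<le>d. \<Sum>j\<le>d. coeff (coeff q i) j * x ^ j * y ^ i)"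
proof -
  have "poly q [:y:] = (\<Sum>i\<le>d. coeff q i * [:y:] ^ i)"
    using poly_eq_sum_upto total_degree_leD(1)[OF assms] .
  moreover have "poly (coeff q i) x = (\<Sum>j\<le>d. coeff (coeff q i) j * x ^ j)" for i
    using poly_eq_sum_upto total_degree_leD(2)[OF assms] .
  ultimately show ?thesis
    by (simp add: eval_xy_def poly_sum sum_distrib_left sum_distrib_right mult_ac)
qed

lemma coeff_pderiv_xy:
  shows "coeff (coeff (pderiv_x q) i) j = real (Suc j) * coeff (coeff q i) (Suc j)"
    and "coeff (coeff (pderiv_y q) i) j = real (Suc i) * coeff (coeff q (Suc i)) j"
  by (simp_all add: pderiv_x_def pderiv_y_def coeff_map_poly coeff_pderiv of_nat_poly del: of_nat_Suc)

lemma total_degree_le_pderiv: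
  assumes "total_degree_le (Suc d) q"
  shows "total_degree_le d (pderiv_x q)" "total_degree_le d (pderiv_y q)"
  using assms unfolding total_degree_le_def by (auto simp: coeff_pderiv_xy) fastforce+

lemma cubic_polar_diagonal:
  assumes "total_degree_le 3 q"
  shows "cubic_polar q (homogeneous_point p) (homogeneous_point p) (homogeneous_point p) = eval_xy q p"
proof -
  obtain x y where p: "p = (x, y)" by (cases p)
  note z = total_degree_leD(3)[OF assms]
  show ?thesis
    unfolding p eval_xy_sum[OF assms] cubic_polar_def monomial_polar_def Let_def
    by (simp add: eval_nat_numeral z algebra_simps)
qed

text \<open>Three times the polar at \<open>(p, p, z)\<close> is the derivative of the homogenised cubic at \<open>(p, 1)\<close> in direction
  \<open>z\<close>. The derivative with respect to the homogenising variable is eliminated by Euler's identity, which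
  leaves \<open>q\<close> and its two affine partial derivatives.\<close>

lemma cubic_polar_gradient:
  assumes q: "total_degree_le 3 q"
    and zero: "eval_xy q p = 0" "eval_xy (pderiv_x q) p = 0" "eval_xy (pderiv_y q) p = 0"
  shows "cubic_polar q (homogeneous_point p) (homogeneous_point p) z = 0"
proof -
  obtain x y where p: "p = (x, y)" by (cases p)
  note z = total_degree_leD(3)[OF q]
  have d: "total_degree_le 2 (pderiv_x q)" "total_degree_le 2 (pderiv_y q)"
    using total_degree_le_pderiv[of 2 q] q by (simp_all add: eval_nat_numeral)
  have "3 * cubic_polar q (homogeneous_point p) (homogeneous_point p) z
    = (z$1 - x * z$3) * eval_xy (pderiv_x q) p + (z$2 - y * z$3) * eval_xy (pderiv_y q) p
      + 3 * z$3 * eval_xy q p"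
    unfolding p eval_xy_sum[OF q] eval_xy_sum[OF d(1)] eval_xy_sum[OF d(2)]
      cubic_polar_def monomial_polar_def Let_def
    by (simp add: eval_nat_numeral z coeff_pderiv_xy field_simps)
  with zero show ?thesis by simp
qed

text \<open>A cubic form that vanishes everywhere vanishes on the line at infinity, where it consists of the
  monomials of degree 3 of \<open>q\<close>; four points of this line detect their coefficients.\<close>

lemma cubic_polar_nontrivial:
  assumes "\<And>x. cubic_polar q x x x = 0" and q: "total_degree_le 3 q"
  shows "total_degree_le 2 q"
proof -
  let ?k = "\<lambda>i j. coeff (coeff q i) j"
  have v: "?k 0 3 * x ^ 3 + ?k 1 2 * x\<^sup>2 * y + ?k 2 1 * x * y\<^sup>2 + ?k 3 0 * y ^ 3 = 0" for x y
    using assms(1)[of "vector [x, y, 0]"]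
    by (simp add: cubic_polar_def monomial_polar_def Let_def power2_eq_square power3_eq_cube mult_ac)
  have k: "?k 0 3 = 0" "?k 3 0 = 0" "?k 1 2 = 0" "?k 2 1 = 0"
    using v[of 1 0] v[of 0 1] v[of 1 1] v[of 1 "-1"] by simp_all
  show ?thesis unfolding total_degree_le_def
  proof (intro allI impI)
    fix i j assume nz: "?k i j \<noteq> 0"
    then have "i + j \<le> 3" using q by (auto simp: total_degree_le_def)
    moreover have "i + j \<noteq> 3"
    proof
      assume "i + j = 3"
      then have "(i, j) \<in> {(0, 3), (1, 2), (2, 1), (3, 0)}" by auto
      then show False using nz k by auto
    qed
    ultimately show "i + j \<le> 2" by simp
  qed
qed

section \<open>The lifted curve and consequences of non-degeneracy\<close>

definition homogeneous_curve ::
    "(nat \<Rightarrow> real \<times> real) \<Rightarrow> (nat \<Rightarrow> real) \<Rightarrow> real \<Rightarrow> real \<Rightarrow> real^3" where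
  "homogeneous_curve c w s t =
     (bez_u w 0 * s ^ 3) *\<^sub>R homogeneous_point (c 0)
     + (bez_u w 1 * s\<^sup>2 * t) *\<^sub>R homogeneous_point (c 1)
     + (bez_u w 2 * s * t\<^sup>2) *\<^sub>R homogeneous_point (c 2)
     + (bez_u w 3 * t ^ 3) *\<^sub>R homogeneous_point (c 3)"

lemma homogeneous_curve_scale:
  "homogeneous_curve c w (r * s) (r * t) = r ^ 3 *\<^sub>R homogeneous_curve c w s t"
  by (simp add: homogeneous_curve_def scaleR_add_right power_mult_distrib power2_eq_square
      power3_eq_cube mult_ac)

lemma homogeneous_curve_affine:
  assumes "bez_denom w t \<noteq> 0"
  shows "homogeneous_curve c w (1 - t) t = bez_denom w t *\<^sub>R homogeneous_point (bez_point c w t)"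
proof -
  have D: "bez_denom w t = bez_u w 0 * (1 - t) ^ 3 + bez_u w 1 * (1 - t)\<^sup>2 * t
      + bez_u w 2 * (1 - t) * t\<^sup>2 + bez_u w 3 * t ^ 3"
    by (simp add: bez_denom_def bez_u_def Bernstein_def eval_nat_numeral algebra_simps)
  have N: "bez_denom w t *\<^sub>R bez_point c w t = (bez_u w 0 * (1 - t) ^ 3) *\<^sub>R c 0
      + (bez_u w 1 * (1 - t)\<^sup>2 * t) *\<^sub>R c 1
      + (bez_u w 2 * (1 - t) * t\<^sup>2) *\<^sub>R c 2 + (bez_u w 3 * t ^ 3) *\<^sub>R c 3"
  proof -
    have "bez_denom w t *\<^sub>R bez_point c w t = (\<Sum>i\<le>3. (w i * Bernstein 3 i t) *\<^sub>R c i)"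
      using assms by (simp add: bez_point_def)
    also have "\<dots> = (bez_u w 0 * (1 - t) ^ 3) *\<^sub>R c 0 + (bez_u w 1 * (1 - t)\<^sup>2 * t) *\<^sub>R c 1
      + (bez_u w 2 * (1 - t) * t\<^sup>2) *\<^sub>R c 2 + (bez_u w 3 * t ^ 3) *\<^sub>R c 3"
      by (simp add: bez_u_def Bernstein_def eval_nat_numeral algebra_simps)
    finally show ?thesis .
  qed
  have "bez_denom w t * fst (bez_point c w t) = fst (bez_denom w t *\<^sub>R bez_point c w t)"
    "bez_denom w t * snd (bez_point c w t) = snd (bez_denom w t *\<^sub>R bez_point c w t)"
    by simp_all
  note fs = this[unfolded N]
  show ?thesis
    unfolding vec_eq_iff forall_3 homogeneous_curve_def
    by (simp add: fs) (simp add: D)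
qed

text \<open>The conics \<open>(a \<bullet> X)(b \<bullet> X) = (d \<bullet> X)\<^sup>2\<close> suffice for all uses of non-degeneracy: they include
  double lines (\<open>a = b = 0\<close>) and the images of quadratic parametrisations.\<close>

lemma no_conic:
  assumes nd: "nondegenerate_curve c w"
    and on_conic: "\<And>t. (a \<bullet> homogeneous_curve c w (1 - t) t) * (b \<bullet> homogeneous_curve c w (1 - t) t)
                     = (d \<bullet> homogeneous_curve c w (1 - t) t)\<^sup>2"
  shows "(a \<bullet> x) * (b \<bullet> x) = (d \<bullet> x)\<^sup>2"
proof -
  define q :: "real poly poly" where "q =
    [: [: a$3 * b$3 - (d$3)\<^sup>2, a$1 * b$3 + a$3 * b$1 - 2 * d$1 * d$3, a$1 * b$1 - (d$1)\<^sup>2 :],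
       [: a$2 * b$3 + a$3 * b$2 - 2 * d$2 * d$3, a$1 * b$2 + a$2 * b$1 - 2 * d$1 * d$2 :],
       [: a$2 * b$2 - (d$2)\<^sup>2 :] :]"
  have eval: "eval_xy q p = (a \<bullet> homogeneous_point p) * (b \<bullet> homogeneous_point p)
      - (d \<bullet> homogeneous_point p)\<^sup>2" for p
    by (simp add: q_def eval_xy_def inner_vec_def sum_3 power2_eq_square algebra_simps)
  have deg: "total_degree_le 2 q"
    unfolding total_degree_le_def q_def
    by (auto simp: coeff_pCons split: nat.splits)
  have "vanishes_on_curve c w q"
    unfolding vanishes_on_curve_def
  proof (intro allI impI)
    fix t assume D: "bez_denom w t \<noteq> 0"
    have "(bez_denom w t)\<^sup>2 * eval_xy q (bez_point c w t) = 0"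
      using on_conic[of t] unfolding homogeneous_curve_affine[OF D]
      by (simp add: eval power2_eq_square algebra_simps)
    with D show "eval_xy q (bez_point c w t) = 0" by simp
  qed
  with nd deg have "q = 0" unfolding nondegenerate_curve_def by blast
  then have z: "a$3 * b$3 - (d$3)\<^sup>2 = 0" "a$1 * b$3 + a$3 * b$1 - 2 * d$1 * d$3 = 0"
    "a$1 * b$1 - (d$1)\<^sup>2 = 0" "a$2 * b$3 + a$3 * b$2 - 2 * d$2 * d$3 = 0"
    "a$1 * b$2 + a$2 * b$1 - 2 * d$1 * d$2 = 0" "a$2 * b$2 - (d$2)\<^sup>2 = 0"
    by (simp_all add: q_def split: if_splits)
  have "(a \<bullet> x) * (b \<bullet> x) - (d \<bullet> x)\<^sup>2
     = (a$3 * b$3 - (d$3)\<^sup>2) * (x$3)\<^sup>2 + (a$1 * b$3 + a$3 * b$1 - 2 * d$1 * d$3) * x$1 * x$3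
       + (a$1 * b$1 - (d$1)\<^sup>2) * (x$1)\<^sup>2 + (a$2 * b$3 + a$3 * b$2 - 2 * d$2 * d$3) * x$2 * x$3
       + (a$1 * b$2 + a$2 * b$1 - 2 * d$1 * d$2) * x$1 * x$2 + (a$2 * b$2 - (d$2)\<^sup>2) * (x$2)\<^sup>2"
    by (simp add: inner_vec_def sum_3 power2_eq_square algebra_simps)
  then show ?thesis by (simp only: z)
qed

lemma no_line:
  assumes "nondegenerate_curve c w" and "\<And>t. n \<bullet> homogeneous_curve c w (1 - t) t = 0"
  shows "n = 0"
  using no_conic[OF assms(1), of 0 0 n n] assms(2) by simp

lemma coplanar_normal:
  fixes x y z :: "real^3"
  assumes "x \<bullet> (y \<times> z) = 0"
  obtains n where "n \<noteq> 0" "n \<bullet> x = 0" "n \<bullet> y = 0" "n \<bullet> z = 0"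
proof -
  let ?A = "vector [x, y, z] :: real^3^3"
  have "det ?A = 0" using assms by (simp add: dot_cross_det)
  then have "\<not> invertible ?A" by (simp add: invertible_det_nz)
  then obtain n where n: "n \<noteq> 0" "?A *v n = 0"
    by (metis invertible_left_inverse matrix_left_invertible_ker)
  then have "x \<bullet> n = 0" "y \<bullet> n = 0" "z \<bullet> n = 0"
    unfolding vec_eq_iff forall_3 by (simp_all add: matrix_vector_mult_def inner_vec_def)
  with n(1) that show ?thesis by (simp add: inner_commute)
qed

text \<open>Without its linear factor the lifted curve is quadratic. If \<open>d0, d1, d2\<close> are independent, the dual basis
  recovers \<open>s\<^sup>2\<close>, \<open>s t\<close>, \<open>t\<^sup>2\<close> up to a common factor, and \<open>s\<^sup>2 t\<^sup>2 = (s t)\<^sup>2\<close> is the equation of a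
  conic; it is a proper condition because it fails at \<open>d1\<close>. If they are dependent, the curve lies on
  a line.\<close>

lemma no_linear_factor:
  assumes nd: "nondegenerate_curve c w"
    and P: "\<And>s t. homogeneous_curve c w s t = (a * s + b * t) *\<^sub>R
              (s\<^sup>2 *\<^sub>R d0 + (s * t) *\<^sub>R d1 + t\<^sup>2 *\<^sub>R d2)"
  shows False
proof (cases "d0 \<bullet> (d1 \<times> d2) = 0")
  case True
  then obtain n where n: "n \<noteq> 0" "n \<bullet> d0 = 0" "n \<bullet> d1 = 0" "n \<bullet> d2 = 0"
    using coplanar_normal by metis
  then have "n \<bullet> homogeneous_curve c w (1 - t) t = 0" for t
    unfolding P by (simp add: inner_add_right)
  with no_line[OF nd] n(1) show False by blast
next
  case False
  let ?D = "d0 \<bullet> (d1 \<times> d2)"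
  have cof: "(d1 \<times> d2) \<bullet> d0 = ?D" "(d2 \<times> d0) \<bullet> d1 = ?D" "(d0 \<times> d1) \<bullet> d2 = ?D"
    by (simp_all add: cross3_simps)
  have "((d1 \<times> d2) \<bullet> d1) * ((d0 \<times> d1) \<bullet> d1) = ((d2 \<times> d0) \<bullet> d1)\<^sup>2"
  proof (rule no_conic[OF nd])
    fix t
    show "((d1 \<times> d2) \<bullet> homogeneous_curve c w (1 - t) t) * ((d0 \<times> d1) \<bullet> homogeneous_curve c w (1 - t) t)
      = ((d2 \<times> d0) \<bullet> homogeneous_curve c w (1 - t) t)\<^sup>2"
      unfolding P using cof
      by (simp add: inner_add_right dot_cross_self power2_eq_square mult_ac)
  qed
  with cof False show False by (simp add: dot_cross_self)
qed

text \<open>A real zero \<open>(s\<^sub>0, t\<^sub>0)\<close> of the lifted curve splits off the linear factor \<open>s\<^sub>0 t - t\<^sub>0 s\<close>; the quotient is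
  given by Horner's scheme.\<close>

lemma no_base_point:
  assumes nd: "nondegenerate_curve c w" and zero: "homogeneous_curve c w s0 t0 = 0"
  shows "s0 = 0 \<and> t0 = 0"
proof (rule ccontr)
  assume nz: "\<not> (s0 = 0 \<and> t0 = 0)"
  define p where "p i = bez_u w i *\<^sub>R homogeneous_point (c i)" for i
  have P: "homogeneous_curve c w s t = s ^ 3 *\<^sub>R p 0 + (s\<^sup>2 * t) *\<^sub>R p 1 + (s * t\<^sup>2) *\<^sub>R p 2 + t ^ 3 *\<^sub>R p 3"
    for s t by (simp add: homogeneous_curve_def p_def mult_ac)
  show False
  proof (cases "s0 = 0")
    case True
    with nz zero have "p 3 = 0" by (simp add: P)
    then show False
      by (intro no_linear_factor[OF nd, of 1 0 "p 0" "p 1" "p 2"])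
        (simp add: P scaleR_add_right power2_eq_square power3_eq_cube mult_ac)
  next
    case False
    define r where "r = t0 / s0"
    have "homogeneous_curve c w (1 / s0 * s0) (1 / s0 * t0) = 0"
      unfolding homogeneous_curve_scale using zero by simp
    then have "p 0 + r *\<^sub>R p 1 + r\<^sup>2 *\<^sub>R p 2 + r ^ 3 *\<^sub>R p 3 = 0"
      using False by (simp add: P r_def)
    then have p0: "p 0 = - (r *\<^sub>R p 1 + r\<^sup>2 *\<^sub>R p 2 + r ^ 3 *\<^sub>R p 3)"
      by (simp add: add_eq_0_iff2 add.assoc)
    show False
      by (rule no_linear_factor[OF nd, of "- r" 1 "p 1 + r *\<^sub>R p 2 + r\<^sup>2 *\<^sub>R p 3" "p 2 + r *\<^sub>R p 3" "p 3"])
        (simp add: P p0 algebra_simps power2_eq_square power3_eq_cube)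
  qed
qed

text \<open>Vanishing on the affine curve speaks only of the parameters \<open>(1 - t, t)\<close> with nonzero denominator. An
  arbitrary pair \<open>(s, t)\<close> is the limit, for \<open>x\<close> tending to 0, of pairs \<open>(s + x, t)\<close> that are multiples of
  such parameters, and the cubic form is homogeneous and continuous.\<close>

lemma cubic_polar_vanishes_on_curve:
  assumes nd: "nondegenerate_curve c w" and q: "total_degree_le 3 q" "vanishes_on_curve c w q"
  shows "let P = homogeneous_curve c w s t in cubic_polar q P P P = 0"
proof -
  interpret symmetric_trilinear "cubic_polar q" by (rule symmetric_trilinear_cubic_polar)
  define Q where "Q s t = (let P = homogeneous_curve c w s t in cubic_polar q P P P)" for s t
  have Q_scale: "Q (r * s) (r * t) = (r ^ 3) ^ 3 * Q s t" for r s t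
    by (simp add: Q_def Let_def homogeneous_curve_scale expand power3_eq_cube)
  have Q_affine: "Q (1 - t) t = 0" if "bez_denom w t \<noteq> 0" for t
    using cubic_polar_diagonal[OF q(1), of "bez_point c w t"] q(2) that
    by (simp add: Q_def Let_def homogeneous_curve_affine expand vanishes_on_curve_def)
  have u0: "bez_u w 0 \<noteq> 0"
    using no_base_point[OF nd, of 1 0] by (auto simp: homogeneous_curve_def)
  \<comment> \<open>The polynomial in \<open>x\<close> of the denominator at \<open>(s + x, t)\<close> times \<open>s + x + t\<close>; its leading coefficient
    is \<open>u\<^sub>0\<close>.\<close>
  define D where "D = (smult (bez_u w 0) ([:s, 1:] ^ 3) + smult (bez_u w 1 * t) ([:s, 1:]\<^sup>2)
     + smult (bez_u w 2 * t\<^sup>2) [:s, 1:] + [:bez_u w 3 * t ^ 3:]) * [:s + t, 1:]"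
  have "coeff D 4 = bez_u w 0"
    by (simp add: D_def eval_nat_numeral)
  with u0 have "D \<noteq> 0" by auto
  then have fin: "finite {x. poly D x = 0}" by (rule poly_roots_finite)
  have Q0: "Q (s + x) t = 0" if D: "poly D x \<noteq> 0" for x
  proof -
    define r where "r = s + x + t"
    have Dx: "poly D x = homogeneous_curve c w (s + x) t $ 3 * r"
      by (simp add: D_def homogeneous_curve_def r_def power2_eq_square power3_eq_cube algebra_simps)
    have r0: "r \<noteq> 0" using D Dx by auto
    define \<tau> where "\<tau> = t / r"
    have st: "s + x = r * (1 - \<tau>)" "t = r * \<tau>"
      using r0 by (auto simp: \<tau>_def right_diff_distrib) (simp add: r_def)
    have "homogeneous_curve c w (s + x) t $ 3 = r ^ 3 * homogeneous_curve c w (1 - \<tau>) \<tau> $ 3"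
      by (simp only: st homogeneous_curve_scale) simp
    also have "homogeneous_curve c w (1 - \<tau>) \<tau> $ 3 = bez_denom w \<tau>"
      by (simp add: homogeneous_curve_def bez_denom_def bez_u_def Bernstein_def eval_nat_numeral algebra_simps)
    finally have "bez_denom w \<tau> \<noteq> 0" using D Dx by auto
    then have "Q (1 - \<tau>) \<tau> = 0" by (rule Q_affine)
    then show ?thesis by (simp add: st Q_scale)
  qed
  obtain d where d: "d > 0" "\<forall>x\<in>{x. poly D x = 0}. x \<noteq> 0 \<longrightarrow> d \<le> dist 0 x"
    using finite_set_avoid[OF fin, of 0] by blast
  have "eventually (\<lambda>x. Q (s + x) t = 0) (at 0)"
    unfolding eventually_at
  proof (intro exI[of _ d] conjI ballI impI)
    fix x :: real assume "x \<noteq> 0 \<and> dist x 0 < d"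
    with d(2) have "poly D x \<noteq> 0" by (force simp: dist_commute)
    then show "Q (s + x) t = 0" by (rule Q0)
  qed (rule d(1))
  then have lim0: "((\<lambda>x. Q (s + x) t) \<longlongrightarrow> 0) (at 0)"
    by (rule tendsto_eventually)
  define R where "R i x = homogeneous_curve c w (s + x) t $ i" for i x
  have R: "isCont (R i) 0" for i
    unfolding R_def[abs_def] homogeneous_curve_def
    by (simp only: vector_add_component vector_scaleR_component real_scaleR_def)
      (intro continuous_intros)
  have Q_R: "Q (s + x) t = (let k = (\<lambda>i j. coeff (coeff q i) j) in
      k 0 0 * R 3 x ^ 3 + k 0 1 * R 1 x * (R 3 x)\<^sup>2 + k 0 2 * (R 1 x)\<^sup>2 * R 3 x + k 0 3 * R 1 x ^ 3
      + k 1 0 * R 2 x * (R 3 x)\<^sup>2 + k 1 1 * R 1 x * R 2 x * R 3 x + k 1 2 * (R 1 x)\<^sup>2 * R 2 x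
      + k 2 0 * (R 2 x)\<^sup>2 * R 3 x + k 2 1 * R 1 x * (R 2 x)\<^sup>2 + k 3 0 * R 2 x ^ 3)" for x
    by (simp add: Q_def R_def Let_def cubic_polar_def monomial_polar_def power2_eq_square
        power3_eq_cube mult_ac)
  have "isCont (\<lambda>x. Q (s + x) t) 0"
    unfolding Q_R Let_def by (intro continuous_intros R)
  then have "((\<lambda>x. Q (s + x) t) \<longlongrightarrow> Q s t) (at 0)"
    by (simp add: isCont_def)
  with lim0 have "Q s t = 0" by (metis LIM_unique)
  then show ?thesis by (simp add: Q_def Let_def)
qed

section \<open>The moving line of the curve and its vertex\<close>

lemma det_eq_triple: "lam_det c i j k =
    homogeneous_point (c i) \<bullet> (homogeneous_point (c j) \<times> homogeneous_point (c k))"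
  by (simp add: lam_det_def dot_cross_det homogeneous_point_def)

text \<open>For \<open>p \<noteq> r\<close>, a coordinate in which they differ determines the only possible \<open>a\<close> with
  \<open>q = a p + (1 - a) r\<close>; the vanishing determinant makes the other coordinate agree.\<close>

lemma collinear_if_triple_zero:
  assumes "homogeneous_point p \<bullet> (homogeneous_point q \<times> homogeneous_point r) = 0"
  shows "collinear {p, q, r}"
proof (cases "p = r")
  case False
  have e: "(fst q - fst r) * (snd p - snd r) = (snd q - snd r) * (fst p - fst r)"
    using assms by (simp add: dot_cross_det homogeneous_point_def det_3 algebra_simps)
  define a where "a = (if fst p = fst r then (snd q - snd r) / (snd p - snd r)
                       else (fst q - fst r) / (fst p - fst r))"
  have "fst q - fst r = a * (fst p - fst r)" "snd q - snd r = a * (snd p - snd r)"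
    using False e by (auto simp: a_def prod_eq_iff field_simps)
  then have "q = a *\<^sub>R p + (1 - a) *\<^sub>R r"
    by (simp add: prod_eq_iff algebra_simps)
  then show ?thesis unfolding collinear_3_expand by blast
qed (simp add: collinear_3_expand)

text \<open>Cramer's rule for four vectors in a space of dimension three.\<close>

lemma lam_relation:
  "lam0 c *\<^sub>R homogeneous_point (c 0) + lam1 c *\<^sub>R homogeneous_point (c 1)
   + lam2 c *\<^sub>R homogeneous_point (c 2) + lam3 c *\<^sub>R homogeneous_point (c 3) = 0"
  unfolding vec_eq_iff forall_3
  by (simp add: lam0_def lam1_def lam2_def lam3_def lam_det_def det_3 algebra_simps)

text \<open>These two relations make the values prescribed for \<open>A\<close> and \<open>B\<close> on the \<open>h\<^sub>i\<close> compatible with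
  \<open>\<Sum> \<lambda>\<^sub>i h\<^sub>i = 0\<close>.\<close>

lemma phi_relations:
  fixes c w
  defines "u \<equiv> bez_u w"
  shows "u 0 * lam1 c * phi2 c w + u 1 * lam2 c * phi3 c w + u 2 * lam3 c * phi1 c w = 0"
    and "lam0 c * u 1 * phi2 c w + lam1 c * u 2 * phi3 c w + lam2 c * u 3 * phi1 c w = 0"
  unfolding u_def phi1_def phi2_def phi3_def by (simp_all add: algebra_simps power2_eq_square)

text \<open>Cofactor expansion of \<open>a \<times> b\<close>: its coordinates in the basis \<open>x, y, z\<close> are the minors of the values
  of \<open>a\<close> and \<open>b\<close> on the basis, up to the determinant of the basis.\<close>

lemma cross_in_basis:
  fixes x y z a b :: "real^3"
  shows "(x \<bullet> (y \<times> z)) *\<^sub>R (a \<times> b) =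
    ((a \<bullet> y) * (b \<bullet> z) - (a \<bullet> z) * (b \<bullet> y)) *\<^sub>R x
    + ((a \<bullet> z) * (b \<bullet> x) - (a \<bullet> x) * (b \<bullet> z)) *\<^sub>R y
    + ((a \<bullet> x) * (b \<bullet> y) - (a \<bullet> y) * (b \<bullet> x)) *\<^sub>R z"
  unfolding vec_eq_iff forall_3 by (simp add: cross3_simps)

text \<open>The covectors \<open>a\<close>, \<open>b\<close>, \<open>v\<close> have a dual basis formed by cross products.\<close>

lemma cross_frame:
  fixes a b x :: "real^3"
  defines "v \<equiv> a \<times> b"
  shows "(v \<bullet> v) *\<^sub>R x = (v \<bullet> x) *\<^sub>R v + ((a \<bullet> x) *\<^sub>R (b \<times> v) + (b \<bullet> x) *\<^sub>R (v \<times> a))"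
  unfolding vec_eq_iff forall_3 v_def by (simp add: cross3_simps)

lemma coeffs_zero_if_triple_nonzero:
  fixes x y z :: "real^3"
  assumes "\<alpha> *\<^sub>R x + \<beta> *\<^sub>R y + \<gamma> *\<^sub>R z = 0" "x \<bullet> (y \<times> z) \<noteq> 0"
  shows "\<alpha> = 0 \<and> \<beta> = 0 \<and> \<gamma> = 0"
proof -
  have "(\<alpha> *\<^sub>R x + \<beta> *\<^sub>R y + \<gamma> *\<^sub>R z) \<bullet> (y \<times> z) = \<alpha> * (x \<bullet> (y \<times> z))"
    "(\<alpha> *\<^sub>R x + \<beta> *\<^sub>R y + \<gamma> *\<^sub>R z) \<bullet> (z \<times> x) = \<beta> * (x \<bullet> (y \<times> z))"
    "(\<alpha> *\<^sub>R x + \<beta> *\<^sub>R y + \<gamma> *\<^sub>R z) \<bullet> (x \<times> y) = \<gamma> * (x \<bullet> (y \<times> z))"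
    by (simp_all add: cross3_simps)
  from this[unfolded assms(1)] assms(2) show ?thesis by simp
qed

lemma covector_with_values:
  fixes x y z :: "real^3"
  assumes "x \<bullet> (y \<times> z) \<noteq> 0"
  obtains n where "n \<bullet> x = \<alpha>" "n \<bullet> y = \<beta>" "n \<bullet> z = \<gamma>"
proof -
  have cyc: "(z \<times> x) \<bullet> y = x \<bullet> (y \<times> z)" "(x \<times> y) \<bullet> z = x \<bullet> (y \<times> z)"
    "(y \<times> z) \<bullet> x = x \<bullet> (y \<times> z)"
    by (simp_all add: cross3_simps)
  let ?n = "(1 / (x \<bullet> (y \<times> z))) *\<^sub>R (\<alpha> *\<^sub>R (y \<times> z) + \<beta> *\<^sub>R (z \<times> x) + \<gamma> *\<^sub>R (x \<times> y))"
  have "?n \<bullet> x = \<alpha>" "?n \<bullet> y = \<beta>" "?n \<bullet> z = \<gamma>"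
    using assms by (simp_all add: inner_add_left dot_cross_self cyc)
  then show ?thesis using that by blast
qed

text \<open>The three products are, up to sign, the coordinates of the vertex in the basis \<open>h\<^sub>0, h\<^sub>2, h\<^sub>3\<close>. Suppose they
  vanish. If \<open>u\<^sub>1\<close> and \<open>u\<^sub>2\<close> are nonzero, then \<open>\<phi>\<^sub>1 = 0\<close> and \<open>\<phi>\<^sub>2 \<phi>\<^sub>3 = 0\<close> say that the ratios
  \<open>\<lambda>\<^sub>i / u\<^sub>i\<close> form a geometric progression, so some \<open>(s, t)\<close> makes the coefficients of \<open>P(s, t)\<close>
  proportional to the \<open>\<lambda>\<^sub>i\<close>; then \<open>P(s, t) = 0\<close> by the linear relation. If just one of \<open>u\<^sub>1\<close>, \<open>u\<^sub>2\<close> is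
  zero, the definitions of the \<open>\<phi>\<^sub>i\<close> leave a nonzero product, and if both are, the curve is a line.\<close>

lemma vertex_coefficients_nonzero:
  fixes c :: "nat \<Rightarrow> real \<times> real" and w :: "nat \<Rightarrow> real"
  defines "u \<equiv> bez_u w"
  assumes nd: "nondegenerate_curve c w"
    and lam: "lam0 c \<noteq> 0" "lam1 c \<noteq> 0" "lam2 c \<noteq> 0" "lam3 c \<noteq> 0"
    and zero: "u 2 * u 3 * (phi1 c w)\<^sup>2 = 0" "u 1 * u 2 * phi1 c w * phi2 c w = 0"
      "(u 1)\<^sup>2 * phi2 c w * phi3 c w = 0"
  shows False
proof -
  have u: "u 0 \<noteq> 0" "u 3 \<noteq> 0"
    using no_base_point[OF nd, of 1 0] no_base_point[OF nd, of 0 1]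
    by (auto simp: homogeneous_curve_def u_def)
  have u12: "u 1 \<noteq> 0 \<or> u 2 \<noteq> 0"
  proof (rule ccontr)
    assume h: "\<not> ?thesis"
    obtain n where n: "n \<noteq> 0" "n \<bullet> homogeneous_point (c 0) = 0" "n \<bullet> homogeneous_point (c 3) = 0"
      using coplanar_normal[of "homogeneous_point (c 0)" "homogeneous_point (c 3)"
          "homogeneous_point (c 3)"] by (metis cross_refl inner_zero_right)
    then have "n \<bullet> homogeneous_curve c w (1 - t) t = 0" for t
      using h by (simp add: homogeneous_curve_def u_def inner_add_right)
    with no_line[OF nd] n(1) show False by blast
  qed
  have both: "u 1 \<noteq> 0" "u 2 \<noteq> 0"
    using u12 zero u lam by (auto simp: phi1_def phi2_def phi3_def u_def)
  have p1: "phi1 c w = 0" using zero(1) both u by simp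
  have p23: "phi2 c w = 0 \<or> phi3 c w = 0" using zero(3) both by simp
  let ?l0 = "lam0 c" and ?l1 = "lam1 c" and ?l2 = "lam2 c" and ?l3 = "lam3 c"
  have e1: "u 0 * u 2 * ?l1\<^sup>2 = (u 1)\<^sup>2 * ?l0 * ?l2" using p1 by (simp add: phi1_def u_def)
  have e3: "u 3 * (u 0)\<^sup>2 * ?l1 ^ 3 = (u 1) ^ 3 * ?l0\<^sup>2 * ?l3"
    using p23
  proof
    assume "phi3 c w = 0"
    then have "u 1 * u 2 * ?l0 * ?l3 = u 0 * u 3 * ?l1 * ?l2" by (simp add: phi3_def u_def)
    with e1 have "?l2 * (u 3 * (u 0)\<^sup>2 * ?l1 ^ 3) = ?l2 * ((u 1) ^ 3 * ?l0\<^sup>2 * ?l3)" by algebra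
    with lam show ?thesis by simp
  next
    assume "phi2 c w = 0"
    then have "u 1 * u 3 * ?l2\<^sup>2 = (u 2)\<^sup>2 * ?l1 * ?l3" by (simp add: phi2_def u_def)
    with e1 have "(u 1 * ?l2\<^sup>2) * (u 3 * (u 0)\<^sup>2 * ?l1 ^ 3)
        = (u 1 * ?l2\<^sup>2) * ((u 1) ^ 3 * ?l0\<^sup>2 * ?l3)" by algebra
    with lam both show ?thesis by simp
  qed
  \<comment> \<open>The common ratio of the progression is \<open>t / s\<close> for \<open>s = \<lambda>\<^sub>0 u\<^sub>1\<close>, \<open>t = \<lambda>\<^sub>1 u\<^sub>0\<close>.\<close>
  have co: "u 0 * (?l0 * u 1) ^ 3 = (u 0 * (u 1) ^ 3 * ?l0\<^sup>2) * ?l0"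
    "u 1 * (?l0 * u 1)\<^sup>2 * (?l1 * u 0) = (u 0 * (u 1) ^ 3 * ?l0\<^sup>2) * ?l1"
    "u 2 * (?l0 * u 1) * (?l1 * u 0)\<^sup>2 = (u 0 * (u 1) ^ 3 * ?l0\<^sup>2) * ?l2"
    "u 3 * (?l1 * u 0) ^ 3 = (u 0 * (u 1) ^ 3 * ?l0\<^sup>2) * ?l3"
    using e1 e3 by algebra+
  have "homogeneous_curve c w (?l0 * u 1) (?l1 * u 0) = (u 0 * (u 1) ^ 3 * ?l0\<^sup>2) *\<^sub>R
    (?l0 *\<^sub>R homogeneous_point (c 0) + ?l1 *\<^sub>R homogeneous_point (c 1)
     + ?l2 *\<^sub>R homogeneous_point (c 2) + ?l3 *\<^sub>R homogeneous_point (c 3))"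
    unfolding homogeneous_curve_def u_def[symmetric] co
    by (simp only: scaleR_add_right scaleR_scaleR)
  then have "homogeneous_curve c w (?l0 * u 1) (?l1 * u 0) = 0"
    unfolding lam_relation by simp
  from no_base_point[OF nd this] lam both show False by simp
qed

text \<open>The relation \<open>s (A \<bullet> P) + t (B \<bullet> P) = 0\<close> requires \<open>A \<bullet> h\<^sub>0 = 0\<close>, \<open>B \<bullet> h\<^sub>3 = 0\<close> and
  \<open>u\<^sub>i\<^sub>+\<^sub>1 (A \<bullet> h\<^sub>i\<^sub>+\<^sub>1) = - u\<^sub>i (B \<bullet> h\<^sub>i)\<close>; together with \<open>\<Sum> \<lambda>\<^sub>i h\<^sub>i = 0\<close> these equations have the solution
  below. Its values on \<open>h\<^sub>0, h\<^sub>2, h\<^sub>3\<close> are prescribed, and those on \<open>h\<^sub>1\<close> follow from the relations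
  between the \<open>\<phi>\<^sub>i\<close>.\<close>

lemma moving_line:
  fixes c :: "nat \<Rightarrow> real \<times> real" and w :: "nat \<Rightarrow> real"
  defines "u \<equiv> bez_u w"
  assumes lam1: "lam1 c \<noteq> 0"
  obtains A B where
    "\<And>s t. A \<bullet> homogeneous_curve c w s t
        = - t * (u 0 * u 1 * phi2 c w * s\<^sup>2 + u 1 * u 2 * phi3 c w * s * t + u 2 * u 3 * phi1 c w * t\<^sup>2)"
    "\<And>s t. B \<bullet> homogeneous_curve c w s t
        = s * (u 0 * u 1 * phi2 c w * s\<^sup>2 + u 1 * u 2 * phi3 c w * s * t + u 2 * u 3 * phi1 c w * t\<^sup>2)"
    "lam1 c *\<^sub>R (A \<times> B) = (u 2 * u 3 * (phi1 c w)\<^sup>2) *\<^sub>R homogeneous_point (c 0)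
        - (u 1 * u 2 * phi1 c w * phi2 c w) *\<^sub>R homogeneous_point (c 2)
        + ((u 1)\<^sup>2 * phi2 c w * phi3 c w) *\<^sub>R homogeneous_point (c 3)"
proof -
  define h where "h i = homogeneous_point (c i)" for i
  let ?f1 = "phi1 c w" and ?f2 = "phi2 c w" and ?f3 = "phi3 c w"
  have l1: "lam1 c = h 0 \<bullet> (h 2 \<times> h 3)"
    unfolding lam1_def det_eq_triple h_def by (simp add: cross3_simps)
  with lam1 have nz: "h 0 \<bullet> (h 2 \<times> h 3) \<noteq> 0" by simp
  obtain A where A: "A \<bullet> h 0 = 0" "A \<bullet> h 2 = - u 1 * ?f3" "A \<bullet> h 3 = - u 2 * ?f1"
    using covector_with_values[OF nz] .
  obtain B where B: "B \<bullet> h 0 = u 1 * ?f2" "B \<bullet> h 2 = u 3 * ?f1" "B \<bullet> h 3 = 0"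
    using covector_with_values[OF nz] .
  have rel: "lam0 c * (n \<bullet> h 0) + lam1 c * (n \<bullet> h 1) + lam2 c * (n \<bullet> h 2) + lam3 c * (n \<bullet> h 3) = 0" for n
    using arg_cong[OF lam_relation, of "\<lambda>x. n \<bullet> x" c] by (simp add: h_def inner_add_right)
  have A1: "A \<bullet> h 1 = - u 0 * ?f2"
  proof -
    have "lam1 c * (A \<bullet> h 1) = lam1 c * (- u 0 * ?f2)"
      using rel[of A] phi_relations(1)[where c=c and w=w] unfolding A u_def by algebra
    then show ?thesis using mult_left_cancel[OF lam1] by blast
  qed
  have B1: "B \<bullet> h 1 = u 2 * ?f3"
  proof -
    have "lam1 c * (B \<bullet> h 1) = lam1 c * (u 2 * ?f3)"
      using rel[of B] phi_relations(2)[where c=c and w=w] unfolding B u_def by algebra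
    then show ?thesis using mult_left_cancel[OF lam1] by blast
  qed
  have P: "n \<bullet> homogeneous_curve c w s t = u 0 * s ^ 3 * (n \<bullet> h 0) + u 1 * s\<^sup>2 * t * (n \<bullet> h 1)
      + u 2 * s * t\<^sup>2 * (n \<bullet> h 2) + u 3 * t ^ 3 * (n \<bullet> h 3)" for n s t
    by (simp add: homogeneous_curve_def h_def u_def inner_add_right)
  show thesis
  proof (rule that[of A B])
    show "A \<bullet> homogeneous_curve c w s t = - t * (u 0 * u 1 * ?f2 * s\<^sup>2 + u 1 * u 2 * ?f3 * s * t
        + u 2 * u 3 * ?f1 * t\<^sup>2)" for s t
      unfolding P A A1 by algebra
    show "B \<bullet> homogeneous_curve c w s t = s * (u 0 * u 1 * ?f2 * s\<^sup>2 + u 1 * u 2 * ?f3 * s * t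
        + u 2 * u 3 * ?f1 * t\<^sup>2)" for s t
      unfolding P B B1 by algebra
    have "(A \<bullet> h 2) * (B \<bullet> h 3) - (A \<bullet> h 3) * (B \<bullet> h 2) = u 2 * u 3 * ?f1\<^sup>2"
      "(A \<bullet> h 3) * (B \<bullet> h 0) - (A \<bullet> h 0) * (B \<bullet> h 3) = - (u 1 * u 2 * ?f1 * ?f2)"
      "(A \<bullet> h 0) * (B \<bullet> h 2) - (A \<bullet> h 2) * (B \<bullet> h 0) = (u 1)\<^sup>2 * ?f2 * ?f3"
      unfolding A B by algebra+
    then show "lam1 c *\<^sub>R (A \<times> B) = (u 2 * u 3 * ?f1\<^sup>2) *\<^sub>R homogeneous_point (c 0)
        - (u 1 * u 2 * ?f1 * ?f2) *\<^sub>R homogeneous_point (c 2)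
        + ((u 1)\<^sup>2 * ?f2 * ?f3) *\<^sub>R homogeneous_point (c 3)"
      using cross_in_basis[of "h 0" "h 2" "h 3" A B] unfolding l1 by (simp add: h_def)
  qed
qed

text \<open>In the basis \<open>v, e1, e2\<close> dual to \<open>v, A, B\<close> (up to scaling and sign) the curve has the form required for the
  uniqueness of the singular point. Coprimality of \<open>g\<close> and \<open>m\<close> is non-degeneracy: a common zero would be a
  zero of \<open>P\<close>, and if \<open>g\<close> divided \<open>m\<close>, then \<open>P / g\<close> would be linear in \<open>(s, t)\<close> and the curve a line.\<close>

lemma double_point_is_vertex:
  assumes nd: "nondegenerate_curve c w" and dp: "is_finite_double_point c w p"
    and g: "binary_form 2 g"
    and A: "\<And>s t. A \<bullet> homogeneous_curve c w s t = t * g s t"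
    and B: "\<And>s t. B \<bullet> homogeneous_curve c w s t = - s * g s t"
    and indep: "A \<times> B \<noteq> 0"
  obtains z where "homogeneous_point p = z *\<^sub>R (A \<times> B)"
proof -
  define v where "v = A \<times> B"
  define N where "N = v \<bullet> v"
  have N: "N \<noteq> 0" using indep by (simp add: N_def v_def)
  define e1 where "e1 = (1 / N) *\<^sub>R (B \<times> v)"
  define e2 where "e2 = - (1 / N) *\<^sub>R (v \<times> A)"
  let ?P = "homogeneous_curve c w"
  define m where "m s t = (v \<bullet> ?P s t) / N" for s t
  have frame: "x = ((v \<bullet> x) / N) *\<^sub>R v + ((A \<bullet> x) *\<^sub>R e1 + (- (B \<bullet> x)) *\<^sub>R e2)" for x
  proof -
    have "x = (1 / N) *\<^sub>R (N *\<^sub>R x)" using N by simp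
    also have "N *\<^sub>R x = (v \<bullet> x) *\<^sub>R v + ((A \<bullet> x) *\<^sub>R (B \<times> v) + (B \<bullet> x) *\<^sub>R (v \<times> A))"
      using cross_frame[of A B x] by (simp add: v_def N_def)
    finally show ?thesis by (simp add: e1_def e2_def scaleR_add_right mult_ac)
  qed
  have P: "?P s t = m s t *\<^sub>R v + g s t *\<^sub>R (t *\<^sub>R e1 + s *\<^sub>R e2)" for s t
    using frame[of "?P s t"] unfolding A B by (simp add: m_def scaleR_add_right mult_ac)
  have mf: "binary_form 3 m"
    by (rule binary_form_3I[of _ "bez_u w 0 * (v \<bullet> homogeneous_point (c 0)) / N"
        "bez_u w 1 * (v \<bullet> homogeneous_point (c 1)) / N" "bez_u w 2 * (v \<bullet> homogeneous_point (c 2)) / N"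
        "bez_u w 3 * (v \<bullet> homogeneous_point (c 3)) / N"])
      (simp add: m_def homogeneous_curve_def inner_add_right add_divide_distrib mult_ac)
  obtain q where q: "total_degree_le 3 q" "\<not> total_degree_le 2 q" "vanishes_on_curve c w q"
    and sing: "eval_xy q p = 0" "eval_xy (pderiv_x q) p = 0" "eval_xy (pderiv_y q) p = 0"
    using dp unfolding is_finite_double_point_def implicit_cubic_def by blast
  interpret symmetric_trilinear "cubic_polar q" by (rule symmetric_trilinear_cubic_polar)
  have no_plane: False if "\<And>s t. ?P s t \<in> span {x, y}" for x y
  proof -
    obtain n where n: "n \<noteq> 0" "n \<bullet> x = 0" "n \<bullet> y = 0"
      using coplanar_normal[of x y y] by (metis cross_refl inner_zero_right)
    have "n \<bullet> z = 0" if "z \<in> span {x, y}" for z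
      using that n by (auto simp: span_insert span_singleton algebra_simps inner_diff_right)
    with no_line[OF nd, of n] that n(1) show False by blast
  qed
  obtain s0 t0 where g0: "g s0 t0 \<noteq> 0"
  proof (rule ccontr)
    assume "\<not> thesis"
    then have "g s t = 0" for s t using that by blast
    then have "?P s t \<in> span {v, v}" for s t by (simp add: P span_base span_scale)
    with no_plane show False by blast
  qed
  obtain x0 where x0: "cubic_polar q x0 x0 x0 \<noteq> 0" using cubic_polar_nontrivial q by blast
  have "\<exists>z. homogeneous_point p = z *\<^sub>R v"
  proof (rule singular_point_unique[OF mf g _ _ _ g0 _ x0])
    show "let P = m s t *\<^sub>R v + g s t *\<^sub>R (t *\<^sub>R e1 + s *\<^sub>R e2) in cubic_polar q P P P = 0" for s t
      using cubic_polar_vanishes_on_curve[OF nd q(1,3), of s t] by (simp only: P)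
    show "s = 0 \<and> t = 0" if "g s t = 0" "m s t = 0" for s t
      using no_base_point[OF nd, of s t] that by (simp add: P)
    show "\<exists>s t. m s t \<noteq> g s t * f s t" if f: "binary_form 1 f" for f
    proof (rule ccontr)
      assume "\<not> ?thesis"
      then have m: "m s t = g s t * f s t" for s t by blast
      obtain a b where ab: "\<And>s t. f s t = a * s + b * t" using binary_form_1E[OF f] by blast
      have "?P s t = (g s t * s) *\<^sub>R (e2 + a *\<^sub>R v) + (g s t * t) *\<^sub>R (e1 + b *\<^sub>R v)" for s t
        by (simp add: P m ab algebra_simps)
      then have "?P s t \<in> span {e2 + a *\<^sub>R v, e1 + b *\<^sub>R v}" for s t
        by (simp add: span_add span_scale span_base)
      with no_plane show False by blast
    qed
    show "\<exists>z a b. x = z *\<^sub>R v + (a *\<^sub>R e1 + b *\<^sub>R e2)" for x using frame by blast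
    show "cubic_polar q (homogeneous_point p) (homogeneous_point p) x = 0" for x
      using cubic_polar_gradient[OF q(1) sing] .
  qed
  then show thesis using that by (auto simp: v_def)
qed

lemma affine_point_of_homogeneous:
  assumes "homogeneous_point s = k *\<^sub>R V"
  shows "V $ 3 \<noteq> 0 \<and> s = (V $ 1, V $ 2) /\<^sub>R V $ 3"
proof -
  have e: "fst s = k * V $ 1" "snd s = k * V $ 2" "1 = k * V $ 3"
    using arg_cong[OF assms, of "\<lambda>x. x $ 1"] arg_cong[OF assms, of "\<lambda>x. x $ 2"]
      arg_cong[OF assms, of "\<lambda>x. x $ 3"] by simp_all
  then have "V $ 3 \<noteq> 0" "k = inverse (V $ 3)"
    using inverse_unique[of "V $ 3" k] by (auto simp: mult.commute)
  with e show ?thesis by (simp add: prod_eq_iff)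
qed

section \<open>Location of the double point\<close>

theorem theorem7:
  fixes c :: "nat \<Rightarrow> real \<times> real" and w :: "nat \<Rightarrow> real" and s :: "real \<times> real"
    and u :: "nat \<Rightarrow> real" and l0 l1 l2 l3 f1 f2 f3 :: real
  assumes no_three_collinear:
      "\<And>i j k. i < j \<Longrightarrow> j < k \<Longrightarrow> k \<le> 3 \<Longrightarrow> \<not> collinear {c i, c j, c k}"
    and nondegenerate: "nondegenerate_curve c w"
    and double_point: "is_finite_double_point c w s"
  defines "u \<equiv> bez_u w"
    and "l0 \<equiv> lam0 c" and "l1 \<equiv> lam1 c" and "l2 \<equiv> lam2 c" and "l3 \<equiv> lam3 c"
    and "f1 \<equiv> phi1 c w" and "f2 \<equiv> phi2 c w" and "f3 \<equiv> phi3 c w"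
  shows
    "(let D = l1 * f1 * f3 * (u 2)\<^sup>2 + 1/2 * (l0 - l1 + l2 - l3) * f1 * f2 * u 1 * u 2
              - l2 * f2 * f3 * (u 1)\<^sup>2
      in D \<noteq> 0 \<and>
         s = ((l1 * f1 * f3 * (u 2)\<^sup>2) *\<^sub>R c 0
              + (1/2 * f1 * f2 * u 1 * u 2) *\<^sub>R
                  (l0 *\<^sub>R c 0 - l1 *\<^sub>R c 1 + l2 *\<^sub>R c 2 - l3 *\<^sub>R c 3)
              - (l2 * f2 * f3 * (u 1)\<^sup>2) *\<^sub>R c 3) /\<^sub>R D) \<and>
     (let D = f1\<^sup>2 * u 2 * u 3 - f1 * f2 * u 1 * u 2 + f2 * f3 * (u 1)\<^sup>2
      in D \<noteq> 0 \<and>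
         s = ((f1\<^sup>2 * u 2 * u 3) *\<^sub>R c 0 - (f1 * f2 * u 1 * u 2) *\<^sub>R c 2
              + (f2 * f3 * (u 1)\<^sup>2) *\<^sub>R c 3) /\<^sub>R D) \<and>
     (let D = f1 * f3 * (u 2)\<^sup>2 - f1 * f2 * u 1 * u 2 + f2\<^sup>2 * u 1 * u 0
      in D \<noteq> 0 \<and>
         s = ((f1 * f3 * (u 2)\<^sup>2) *\<^sub>R c 0 - (f1 * f2 * u 1 * u 2) *\<^sub>R c 1
              + (f2\<^sup>2 * u 1 * u 0) *\<^sub>R c 3) /\<^sub>R D)"
proof -
  define h where "h i = homogeneous_point (c i)" for i
  have lam: "l0 \<noteq> 0" "l1 \<noteq> 0" "l2 \<noteq> 0" "l3 \<noteq> 0"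
    using no_three_collinear[of 1 2 3] no_three_collinear[of 0 2 3] no_three_collinear[of 0 1 3]
      no_three_collinear[of 0 1 2] collinear_if_triple_zero[of "c 3" "c 2" "c 1"]
      collinear_if_triple_zero[of "c 2" "c 3" "c 0"] collinear_if_triple_zero[of "c 1" "c 0" "c 3"]
      collinear_if_triple_zero[of "c 0" "c 1" "c 2"]
    unfolding l0_def l1_def l2_def l3_def lam0_def lam1_def lam2_def lam3_def det_eq_triple
    by (auto simp: insert_commute)
  obtain A B where
    A: "\<And>s t. A \<bullet> homogeneous_curve c w s t
        = - t * (u 0 * u 1 * f2 * s\<^sup>2 + u 1 * u 2 * f3 * s * t + u 2 * u 3 * f1 * t\<^sup>2)" and
    B: "\<And>s t. B \<bullet> homogeneous_curve c w s t
        = s * (u 0 * u 1 * f2 * s\<^sup>2 + u 1 * u 2 * f3 * s * t + u 2 * u 3 * f1 * t\<^sup>2)" and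
    AB: "l1 *\<^sub>R (A \<times> B) = (u 2 * u 3 * f1\<^sup>2) *\<^sub>R h 0 - (u 1 * u 2 * f1 * f2) *\<^sub>R h 2
        + ((u 1)\<^sup>2 * f2 * f3) *\<^sub>R h 3"
    using moving_line[of c w] lam(2) unfolding l1_def u_def f1_def f2_def f3_def h_def by blast
  have indep: "A \<times> B \<noteq> 0"
  proof
    assume "A \<times> B = 0"
    then have "(u 2 * u 3 * f1\<^sup>2) *\<^sub>R h 0 + (- (u 1 * u 2 * f1 * f2)) *\<^sub>R h 2
        + ((u 1)\<^sup>2 * f2 * f3) *\<^sub>R h 3 = 0"
      using AB by simp
    moreover have "h 0 \<bullet> (h 2 \<times> h 3) \<noteq> 0"
      using lam(2) unfolding l1_def lam1_def det_eq_triple h_def by (simp add: cross3_simps)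
    ultimately have "u 2 * u 3 * f1\<^sup>2 = 0 \<and> - (u 1 * u 2 * f1 * f2) = 0 \<and> (u 1)\<^sup>2 * f2 * f3 = 0"
      by (rule coeffs_zero_if_triple_nonzero)
    then show False
      using vertex_coefficients_nonzero[OF nondegenerate] lam
      unfolding u_def f1_def f2_def f3_def l0_def l1_def l2_def l3_def by simp
  qed
  define g where "g s t = - (u 0 * u 1 * f2 * s\<^sup>2 + u 1 * u 2 * f3 * s * t + u 2 * u 3 * f1 * t\<^sup>2)"
    for s t
  have g: "binary_form 2 g"
    by (rule binary_form_2I[of _ "- (u 0 * u 1 * f2)" "- (u 1 * u 2 * f3)" "- (u 2 * u 3 * f1)"])
      (simp add: g_def)
  have "A \<bullet> homogeneous_curve c w s t = t * g s t" "B \<bullet> homogeneous_curve c w s t = - s * g s t"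
    for s t unfolding A B g_def by (simp_all add: algebra_simps)
  then obtain z where z: "homogeneous_point s = z *\<^sub>R (A \<times> B)"
    using double_point_is_vertex[OF nondegenerate double_point g _ _ indep] by blast

  define V1 where "V1 = (l1 * f1 * f3 * (u 2)\<^sup>2) *\<^sub>R h 0
    + (1/2 * f1 * f2 * u 1 * u 2) *\<^sub>R (l0 *\<^sub>R h 0 - l1 *\<^sub>R h 1 + l2 *\<^sub>R h 2 - l3 *\<^sub>R h 3)
    - (l2 * f2 * f3 * (u 1)\<^sup>2) *\<^sub>R h 3"
  define V2 where "V2 = (f1\<^sup>2 * u 2 * u 3) *\<^sub>R h 0 - (f1 * f2 * u 1 * u 2) *\<^sub>R h 2
    + (f2 * f3 * (u 1)\<^sup>2) *\<^sub>R h 3"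
  define V3 where "V3 = (f1 * f3 * (u 2)\<^sup>2) *\<^sub>R h 0 - (f1 * f2 * u 1 * u 2) *\<^sub>R h 1
    + (f2\<^sup>2 * u 1 * u 0) *\<^sub>R h 3"
  note rel = lam_relation[of c, folded l0_def l1_def l2_def l3_def h_def]
  note phi = phi_relations[where c = c and w = w,
      folded l0_def l1_def l2_def l3_def u_def f1_def f2_def f3_def]
  \<comment> \<open>The three numerators, lifted to \<open>\<real>\<^sup>3\<close>, are proportional: \<open>V1 = - l2 V2 = l1 V3\<close>.\<close>
  have "V2 = l1 *\<^sub>R (A \<times> B)" unfolding AB V2_def by (simp add: mult_ac)
  then have s2: "homogeneous_point s = (z / l1) *\<^sub>R V2" using z lam by simp
  have "V1 + l2 *\<^sub>R V2 = (f1 * u 2 * (l0 * u 1 * f2 + l1 * u 2 * f3 + l2 * u 3 * f1)) *\<^sub>R h 0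
      - (f1 * f2 * u 1 * u 2 / 2) *\<^sub>R (l0 *\<^sub>R h 0 + l1 *\<^sub>R h 1 + l2 *\<^sub>R h 2 + l3 *\<^sub>R h 3)"
    unfolding V1_def V2_def vec_eq_iff by (simp add: field_simps power2_eq_square)
  then have V12: "V1 = - l2 *\<^sub>R V2" unfolding rel phi by (simp add: add_eq_0_iff2)
  have "V1 - l1 *\<^sub>R V3 = (f1 * f2 * u 1 * u 2 / 2) *\<^sub>R (l0 *\<^sub>R h 0 + l1 *\<^sub>R h 1 + l2 *\<^sub>R h 2 + l3 *\<^sub>R h 3)
      - (f2 * u 1 * (u 0 * l1 * f2 + u 1 * l2 * f3 + u 2 * l3 * f1)) *\<^sub>R h 3"
    unfolding V1_def V3_def vec_eq_iff by (simp add: field_simps power2_eq_square)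
  then have V13: "V1 = l1 *\<^sub>R V3" unfolding rel phi by simp
  have s1: "homogeneous_point s = (- z / (l1 * l2)) *\<^sub>R V1"
    unfolding s2 V12 using lam by simp
  have s3: "homogeneous_point s = (- z / l2) *\<^sub>R V3"
    unfolding s1 V13 using lam by simp
  have V1_coords: "V1 $ 3 = l1 * f1 * f3 * (u 2)\<^sup>2
        + 1/2 * (l0 - l1 + l2 - l3) * f1 * f2 * u 1 * u 2 - l2 * f2 * f3 * (u 1)\<^sup>2"
    "(V1 $ 1, V1 $ 2) = (l1 * f1 * f3 * (u 2)\<^sup>2) *\<^sub>R c 0
        + (1/2 * f1 * f2 * u 1 * u 2) *\<^sub>R
            (l0 *\<^sub>R c 0 - l1 *\<^sub>R c 1 + l2 *\<^sub>R c 2 - l3 *\<^sub>R c 3)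
        - (l2 * f2 * f3 * (u 1)\<^sup>2) *\<^sub>R c 3"
    unfolding V1_def h_def by (simp_all add: prod_eq_iff)
  have V2_coords: "V2 $ 3 = f1\<^sup>2 * u 2 * u 3 - f1 * f2 * u 1 * u 2 + f2 * f3 * (u 1)\<^sup>2"
    "(V2 $ 1, V2 $ 2) = (f1\<^sup>2 * u 2 * u 3) *\<^sub>R c 0 - (f1 * f2 * u 1 * u 2) *\<^sub>R c 2
        + (f2 * f3 * (u 1)\<^sup>2) *\<^sub>R c 3"
    unfolding V2_def h_def by (simp_all add: prod_eq_iff)
  have V3_coords: "V3 $ 3 = f1 * f3 * (u 2)\<^sup>2 - f1 * f2 * u 1 * u 2 + f2\<^sup>2 * u 1 * u 0"
    "(V3 $ 1, V3 $ 2) = (f1 * f3 * (u 2)\<^sup>2) *\<^sub>R c 0 - (f1 * f2 * u 1 * u 2) *\<^sub>R c 1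
        + (f2\<^sup>2 * u 1 * u 0) *\<^sub>R c 3"
    unfolding V3_def h_def by (simp_all add: prod_eq_iff)
  show ?thesis
    unfolding Let_def
    using affine_point_of_homogeneous[OF s1, unfolded V1_coords]
      affine_point_of_homogeneous[OF s2, unfolded V2_coords]
      affine_point_of_homogeneous[OF s3, unfolded V3_coords]
    by blast
qed

end
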